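(* Let $L,T>0$, $\Omega=(0,L)\times(0,T)$, $\alpha>0$, and let $v_c$ be a given finite bound defining $\mathcal{V}_{ad}=\{v\in L^2(0,L):\|v\|_{L^2(0,L)}\le v_c\}$. Let $k\in L^\infty(0,L)$ be positive and finite-valued, $w\in H^2(0,L)$, $F\in L^2(\Omega)$, and $y\in L^2(\Omega)$. For $v\in\mathcal{V}_{ad}$ let $u(x,t;v)$ be the weak solution of the beam problem with data $(w,v,F)$ and let $\psi(x,t;v)$ be the weak solution of the adjoint problem corresponding to $u(\cdot,\cdot;v)$. Then the cost functional $$J_\alpha(v)=\int_0^T\int_0^L\big[u(x,t;v)-y(x,t)\big]^2\,dx\,dt+\alpha\int_0^L v(x)^2\,dx ,\qquad v\in\mathcal{V}_{ad},$$ is Fréchet differentiable, and its derivative is given by $$J'_\alpha(v)=-\psi(x,0;v)+2\alpha v .$$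
   Context: All functions are real-valued. $H^{2,1}(\Omega)$ is the space of all $f\in L^2(\Omega)$ with weak derivatives $f_t,f_x,f_{xx}\in L^2(\Omega)$, with norm $\|f\|_{H^{2,1}(\Omega)}=\big(\int_0^T\int_0^L[f^2+f_t^2+f_x^2+f_{xx}^2]\,dx\,dt\big)^{1/2}$. $\hat H^{2,1}(\Omega)$ is the subset of those $f\in H^{2,1}(\Omega)$ with $f(0,t)=f(L,t)=0$ for all $t\in[0,T]$, with the same norm. The beam problem with data $(w,v,F)$ is: $u_{tt}+(k(x)u_{xx})_{xx}=F(x,t)$ in $\Omega$; $u(x,0)=w(x)$, $u_t(x,0)=v(x)$ for $x\in(0,L)$; $u(0,t)=u(L,t)=u_{xx}(0,t)=u_{xx}(L,t)=0$ for $t\in(0,T)$. A weak solution is a function $u\in\hat H^{2,1}(\Omega)$ with $u(x,0)=w(x)$ for $x\in(0,L)$ such that $$\int_0^T\int_0^L(-u_t\eta_t+k(x)u_{xx}\eta_{xx})\,dx\,dt=\int_0^T\int_0^L\eta F\,dx\,dt+\int_0^L v(x)\eta(x,0)\,dx$$ for all $\eta\in\hat H^{2,1}(\Omega)$ with $\eta(x,T)=0$ for all $x\in(0,L)$. The adjoint problem corresponding to $u$ is: $\psi_{tt}+(k(x)\psi_{xx})_{xx}=-2[u(x,t)-y(x,t)]$ in $\Omega$; $\psi(x,T)=0$, $\psi_t(x,T)=0$ for $x\in(0,L)$; $\psi(0,t)=\psi(L,t)=\psi_{xx}(0,t)=\psi_{xx}(L,t)=0$ for $t\in(0,T)$. The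 substitution $t\mapsto T-t$ turns it into a beam problem with zero initial data, and its weak solution is understood accordingly: $\psi\in\hat H^{2,1}(\Omega)$, $\psi(x,T)=0$, and $\int_0^T\int_0^L(-\psi_t\eta_t+k\psi_{xx}\eta_{xx})\,dx\,dt=-2\int_0^T\int_0^L(u-y)\eta\,dx\,dt$ for all $\eta\in\hat H^{2,1}(\Omega)$ with $\eta(x,0)=0$ for all $x\in(0,L)$. The Fréchet derivative of $J_\alpha$ at $v\in\mathcal{V}_{ad}$ is identified with a function $J'_\alpha(v)\in L^2(0,L)$ satisfying $J_\alpha(v+\delta v)-J_\alpha(v)=\langle J'_\alpha(v),\delta v\rangle_{L^2(0,L)}+o(\|\delta v\|_{L^2(0,L)})$ for increments $\delta v\in L^2(0,L)$ with $v+\delta v\in\mathcal{V}_{ad}$, where $\langle f,g\rangle_{L^2(0,L)}=\int_0^L fg\,dx$. *)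

theory Defs
  imports "HOL-Analysis.Analysis"
begin

section \<open>Lebesgue spaces and weak derivatives\<close>

text \<open>
  Elements of the function spaces are functions, not classes modulo null sets. Values outside the
  domain play no role.
\<close>

definition L2 :: "'a::euclidean_space set \<Rightarrow> ('a \<Rightarrow> real) set" where
  "L2 S = {f. f \<in> borel_measurable (lebesgue_on S) \<and> integrable (lebesgue_on S) (\<lambda>z. (f z)\<^sup>2)}"

definition L2_inner :: "'a::euclidean_space set \<Rightarrow> ('a \<Rightarrow> real) \<Rightarrow> ('a \<Rightarrow> real) \<Rightarrow> real" where
  "L2_inner S f g = (LINT z|lebesgue_on S. f z * g z)"

definition L2_norm :: "'a::euclidean_space set \<Rightarrow> ('a \<Rightarrow> real) \<Rightarrow> real" where
  "L2_norm S f = sqrt (LINT z|lebesgue_on S. (f z)\<^sup>2)"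

definition Linf :: "'a::euclidean_space set \<Rightarrow> ('a \<Rightarrow> real) set" where
  "Linf S = {f. f \<in> borel_measurable (lebesgue_on S) \<and> (\<exists>C. AE z in lebesgue_on S. \<bar>f z\<bar> \<le> C)}"

fun Ck :: "nat \<Rightarrow> ('a::euclidean_space \<Rightarrow> real) \<Rightarrow> bool" where
  "Ck 0 f \<longleftrightarrow> continuous_on UNIV f"
| "Ck (Suc n) f \<longleftrightarrow> (\<forall>z. f differentiable (at z)) \<and>
     (\<forall>i\<in>Basis. Ck n (\<lambda>z. frechet_derivative f (at z) i))"

definition test_functions :: "'a::euclidean_space set \<Rightarrow> ('a \<Rightarrow> real) set" where
  "test_functions S = {\<phi>. (\<forall>n. Ck n \<phi>) \<and>
     compact (closure {z. \<phi> z \<noteq> 0}) \<and> closure {z. \<phi> z \<noteq> 0} \<subseteq> S}"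

text \<open>\<open>g\<close> is a square-integrable weak partial derivative of \<open>f\<close> in the direction \<open>i\<close>.\<close>

definition is_weak_deriv ::
    "'a::euclidean_space set \<Rightarrow> 'a \<Rightarrow> ('a \<Rightarrow> real) \<Rightarrow> ('a \<Rightarrow> real) \<Rightarrow> bool" where
  "is_weak_deriv S i f g \<longleftrightarrow> f \<in> L2 S \<and> g \<in> L2 S \<and>
     (\<forall>\<phi>\<in>test_functions S.
        (LINT z|lebesgue_on S. f z * frechet_derivative \<phi> (at z) i)
          = - (LINT z|lebesgue_on S. g z * \<phi> z))"

definition weakly_diff :: "'a::euclidean_space set \<Rightarrow> 'a \<Rightarrow> ('a \<Rightarrow> real) \<Rightarrow> bool" where
  "weakly_diff S i f \<longleftrightarrow> (\<exists>g. is_weak_deriv S i f g)"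

text \<open>For open \<open>S\<close> the weak derivative is determined up to a null set; one version is chosen.\<close>

definition wderiv :: "'a::euclidean_space set \<Rightarrow> 'a \<Rightarrow> ('a \<Rightarrow> real) \<Rightarrow> 'a \<Rightarrow> real" where
  "wderiv S i f = (SOME g. is_weak_deriv S i f g)"

definition H2 :: "real set \<Rightarrow> (real \<Rightarrow> real) set" where
  "H2 S = {f \<in> L2 S. weakly_diff S 1 f \<and> weakly_diff S 1 (wderiv S 1 f)}"


section \<open>The anisotropic spaces on the space-time rectangle\<close>

text \<open>Points of the rectangle are pairs \<open>(x, t)\<close>: space first, then time.\<close>

definition Omega :: "real \<Rightarrow> real \<Rightarrow> (real \<times> real) set" where
  "Omega L T = {0<..<L} \<times> {0<..<T}"

definition Dt :: "real \<Rightarrow> real \<Rightarrow> (real \<times> real \<Rightarrow> real) \<Rightarrow> real \<times> real \<Rightarrow> real" where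
  "Dt L T f = wderiv (Omega L T) (0, 1) f"

definition Dx :: "real \<Rightarrow> real \<Rightarrow> (real \<times> real \<Rightarrow> real) \<Rightarrow> real \<times> real \<Rightarrow> real" where
  "Dx L T f = wderiv (Omega L T) (1, 0) f"

definition Dxx :: "real \<Rightarrow> real \<Rightarrow> (real \<times> real \<Rightarrow> real) \<Rightarrow> real \<times> real \<Rightarrow> real" where
  "Dxx L T f = Dx L T (Dx L T f)"

definition H21 :: "real \<Rightarrow> real \<Rightarrow> (real \<times> real \<Rightarrow> real) set" where
  "H21 L T = {f \<in> L2 (Omega L T).
     weakly_diff (Omega L T) (0, 1) f \<and>
     weakly_diff (Omega L T) (1, 0) f \<and>
     weakly_diff (Omega L T) (1, 0) (Dx L T f)}"

text \<open>
  In one space dimension \<open>H\<^sup>2\<^sup>,\<^sup>1\<close> embeds into the continuous functions on the closed rectangle, and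
  pointwise values such as \<open>f(0,t)\<close> and \<open>f(x,0)\<close> are those of the continuous representative.
  Elements of \<open>H21_hat\<close> are therefore taken to be that representative; its values on the sides of
  the rectangle are the traces.
\<close>

definition H21_hat :: "real \<Rightarrow> real \<Rightarrow> (real \<times> real \<Rightarrow> real) set" where
  "H21_hat L T = {f \<in> H21 L T. continuous_on ({0..L} \<times> {0..T}) f \<and>
     (\<forall>t\<in>{0..T}. f (0, t) = 0 \<and> f (L, t) = 0)}"


section \<open>Weak solutions of the beam problem and of its adjoint\<close>

definition beam_weak_solution ::
    "real \<Rightarrow> real \<Rightarrow> (real \<Rightarrow> real) \<Rightarrow> (real \<Rightarrow> real) \<Rightarrow> (real \<Rightarrow> real) \<Rightarrow>
      (real \<times> real \<Rightarrow> real) \<Rightarrow> (real \<times> real \<Rightarrow> real) \<Rightarrow> bool" where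
  "beam_weak_solution L T k w v F u \<longleftrightarrow>
     u \<in> H21_hat L T \<and>
     (AE x in lebesgue_on {0<..<L}. u (x, 0) = w x) \<and>
     (\<forall>\<eta>\<in>H21_hat L T. (\<forall>x\<in>{0<..<L}. \<eta> (x, T) = 0) \<longrightarrow>
        (LINT z|lebesgue_on (Omega L T).
            - Dt L T u z * Dt L T \<eta> z + k (fst z) * Dxx L T u z * Dxx L T \<eta> z)
          = (LINT z|lebesgue_on (Omega L T). \<eta> z * F z)
            + (LINT x|lebesgue_on {0<..<L}. v x * \<eta> (x, 0)))"

definition adjoint_weak_solution ::
    "real \<Rightarrow> real \<Rightarrow> (real \<Rightarrow> real) \<Rightarrow> (real \<times> real \<Rightarrow> real) \<Rightarrow> (real \<times> real \<Rightarrow> real) \<Rightarrow>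
      (real \<times> real \<Rightarrow> real) \<Rightarrow> bool" where
  "adjoint_weak_solution L T k y u \<psi> \<longleftrightarrow>
     \<psi> \<in> H21_hat L T \<and>
     (\<forall>x\<in>{0<..<L}. \<psi> (x, T) = 0) \<and>
     (\<forall>\<eta>\<in>H21_hat L T. (\<forall>x\<in>{0<..<L}. \<eta> (x, 0) = 0) \<longrightarrow>
        (LINT z|lebesgue_on (Omega L T).
            - Dt L T \<psi> z * Dt L T \<eta> z + k (fst z) * Dxx L T \<psi> z * Dxx L T \<eta> z)
          = - 2 * (LINT z|lebesgue_on (Omega L T). (u z - y z) * \<eta> z))"


section \<open>The cost functional and its derivative\<close>

definition V_ad :: "real \<Rightarrow> real \<Rightarrow> (real \<Rightarrow> real) set" where
  "V_ad L v\<^sub>c = {v \<in> L2 {0<..<L}. L2_norm {0<..<L} v \<le> v\<^sub>c}"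

text \<open>\<open>u v\<close> is the state belonging to the control \<open>v\<close>.\<close>

definition cost ::
    "real \<Rightarrow> real \<Rightarrow> real \<Rightarrow> (real \<times> real \<Rightarrow> real) \<Rightarrow>
      ((real \<Rightarrow> real) \<Rightarrow> real \<times> real \<Rightarrow> real) \<Rightarrow> (real \<Rightarrow> real) \<Rightarrow> real" where
  "cost L T \<alpha> y u v =
     (LINT z|lebesgue_on (Omega L T). (u v z - y z)\<^sup>2)
     + \<alpha> * (LINT x|lebesgue_on {0<..<L}. (v x)\<^sup>2)"

text \<open>
  Frechet differentiability at \<open>v\<close> relative to the admissible set \<open>A\<close>, the derivative being
  represented by \<open>g\<close> through the inner product of \<open>L2 S\<close>.
\<close>

definition has_frechet_gradient ::
    "'a::euclidean_space set \<Rightarrow> ('a \<Rightarrow> real) set \<Rightarrow> (('a \<Rightarrow> real) \<Rightarrow> real) \<Rightarrow>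
      ('a \<Rightarrow> real) \<Rightarrow> ('a \<Rightarrow> real) \<Rightarrow> bool" where
  "has_frechet_gradient S A J v g \<longleftrightarrow>
     g \<in> L2 S \<and>
     (\<forall>\<epsilon>>0. \<exists>\<delta>>0. \<forall>h\<in>L2 S. (\<lambda>x. v x + h x) \<in> A \<longrightarrow> L2_norm S h < \<delta> \<longrightarrow>
        \<bar>J (\<lambda>x. v x + h x) - J v - L2_inner S g h\<bar> \<le> \<epsilon> * L2_norm S h)"

end

theory Submission
  imports Defs
begin

text \<open>
  Testing the state equation with \<open>\<psi>\<close> and the adjoint equation with a difference of two states gives
  \<open>2 \<langle>u\<^sub>c - y, u\<^sub>a - u\<^sub>b\<rangle> = - \<langle>\<psi>\<^sub>c(\<cdot>, 0), a - b\<rangle>\<close> for all controls \<open>a\<close>, \<open>b\<close>, \<open>c\<close>. Hence the remainder in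
  the expansion of the cost functional is \<open>\<parallel>\<delta>u\<parallel>\<^sup>2 + \<alpha> \<parallel>h\<parallel>\<^sup>2\<close>, where
  \<open>2 \<parallel>\<delta>u\<parallel>\<^sup>2 = - \<langle>\<delta>\<psi>(\<cdot>, 0), h\<rangle>\<close>. The bound \<open>\<parallel>\<delta>\<psi>(\<cdot>, 0)\<parallel> \<le> C \<parallel>h\<parallel>\<close> needs no energy estimate: the
  duality makes \<open>h \<mapsto> \<delta>\<psi>(\<cdot>, 0)\<close> symmetric, so as in the Hellinger--Toeplitz theorem it follows from the
  uniform boundedness principle applied to the functions \<open>\<delta>\<psi>(\<cdot>, 0) / \<parallel>h\<parallel>\<close>.
\<close>

section \<open>The space of square-integrable functions\<close>

lemma L2_measurable: "f \<in> L2 S \<Longrightarrow> f \<in> borel_measurable (lebesgue_on S)"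
  and L2_integrable_square: "f \<in> L2 S \<Longrightarrow> integrable (lebesgue_on S) (\<lambda>z. (f z)\<^sup>2)"
  by (auto simp: L2_def)

lemma L2_bound:
  assumes "f \<in> borel_measurable (lebesgue_on S)" "integrable (lebesgue_on S) g"
    and "AE z in lebesgue_on S. (f z)\<^sup>2 \<le> g z"
  shows "f \<in> L2 S"
proof -
  have "integrable (lebesgue_on S) (\<lambda>z. (f z)\<^sup>2)"
    by (rule Bochner_Integration.integrable_bound[OF assms(2)]) (use assms in auto)
  then show ?thesis using assms by (simp add: L2_def)
qed

lemma L2_integrable_mult:
  assumes "f \<in> L2 S" "g \<in> L2 S"
  shows "integrable (lebesgue_on S) (\<lambda>z. f z * g z)"
proof (rule Bochner_Integration.integrable_bound)
  show "integrable (lebesgue_on S) (\<lambda>z. (f z)\<^sup>2 + (g z)\<^sup>2)"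
    using assms by (simp add: L2_def)
  show "(\<lambda>z. f z * g z) \<in> borel_measurable (lebesgue_on S)"
    by (intro borel_measurable_times L2_measurable assms)
  have "\<bar>a * b\<bar> \<le> a\<^sup>2 + b\<^sup>2" for a b :: real
    using sum_squares_bound[of "\<bar>a\<bar>" "\<bar>b\<bar>"] mult_nonneg_nonneg[of "\<bar>a\<bar>" "\<bar>b\<bar>"]
    unfolding abs_mult power2_abs by linarith
  then show "AE z in lebesgue_on S. norm (f z * g z) \<le> norm ((f z)\<^sup>2 + (g z)\<^sup>2)"
    by simp
qed

lemma L2_scale: "f \<in> L2 S \<Longrightarrow> (\<lambda>z. c * f z) \<in> L2 S"
  by (auto simp: L2_def power_mult_distrib intro: borel_measurable_times)

lemma L2_add:
  assumes "f \<in> L2 S" "g \<in> L2 S"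
  shows "(\<lambda>z. f z + g z) \<in> L2 S"
  using L2_integrable_mult[OF assms] assms
  by (auto simp: L2_def power2_sum mult.assoc intro: borel_measurable_add)

lemma L2_diff:
  assumes "f \<in> L2 S" "g \<in> L2 S"
  shows "(\<lambda>z. f z - g z) \<in> L2 S"
  using L2_add[OF assms(1) L2_scale[OF assms(2), of "- 1"]] by simp

lemma L2_zero: "(\<lambda>z. 0) \<in> L2 S"
  by (simp add: L2_def)

lemma L2_sum: "(\<And>i. i \<in> A \<Longrightarrow> f i \<in> L2 S) \<Longrightarrow> (\<lambda>z. \<Sum>i\<in>A. f i z) \<in> L2 S"
  by (induction A rule: infinite_finite_induct) (auto intro: L2_zero L2_add)

lemma L2_abs: "f \<in> L2 S \<Longrightarrow> (\<lambda>z. \<bar>f z\<bar>) \<in> L2 S"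
  by (auto simp: L2_def intro: borel_measurable_abs)

lemma L2_norm_nonneg: "0 \<le> L2_norm S f"
  by (simp add: L2_norm_def)

lemma L2_norm_square: "(L2_norm S f)\<^sup>2 = (LINT z|lebesgue_on S. (f z)\<^sup>2)"
  by (simp add: L2_norm_def)

lemma L2_norm_scale: "L2_norm S (\<lambda>z. c * f z) = \<bar>c\<bar> * L2_norm S f"
  by (simp add: L2_norm_def power_mult_distrib real_sqrt_mult)

lemma L2_inner_commute: "L2_inner S f g = L2_inner S g f"
  by (simp add: L2_inner_def mult.commute)

lemma L2_inner_self: "L2_inner S f f = (L2_norm S f)\<^sup>2"
  unfolding L2_norm_square by (simp add: L2_inner_def power2_eq_square)

lemma L2_inner_scale_left: "L2_inner S (\<lambda>z. c * f z) g = c * L2_inner S f g"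
  and L2_inner_scale_right: "L2_inner S f (\<lambda>z. c * g z) = c * L2_inner S f g"
  by (simp_all add: L2_inner_def mult.left_commute mult.assoc)

lemma L2_inner_add_left:
  assumes "f \<in> L2 S" "g \<in> L2 S" "h \<in> L2 S"
  shows "L2_inner S (\<lambda>z. f z + g z) h = L2_inner S f h + L2_inner S g h"
  using assms by (simp add: L2_inner_def distrib_right L2_integrable_mult)

lemma L2_inner_diff_left:
  assumes "f \<in> L2 S" "g \<in> L2 S" "h \<in> L2 S"
  shows "L2_inner S (\<lambda>z. f z - g z) h = L2_inner S f h - L2_inner S g h"
  using assms by (simp add: L2_inner_def left_diff_distrib L2_integrable_mult)

lemma L2_norm_square_add:
  assumes "f \<in> L2 S" "g \<in> L2 S"
  shows "(L2_norm S (\<lambda>z. f z + g z))\<^sup>2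
    = (L2_norm S f)\<^sup>2 + 2 * L2_inner S f g + (L2_norm S g)\<^sup>2"
  using assms L2_integrable_mult[OF assms]
  by (simp add: L2_norm_square L2_inner_def power2_sum L2_integrable_square mult.assoc)

text \<open>Cauchy-Schwarz: the squared norm of \<open>f + t * g\<close> is a quadratic polynomial
  in \<open>t\<close> that is never negative, and its value at the minimiser gives the inequality. A
  vanishing leading coefficient is treated apart.\<close>

lemma L2_inner_abs_le:
  assumes f: "f \<in> L2 S" and g: "g \<in> L2 S"
  shows "\<bar>L2_inner S f g\<bar> \<le> L2_norm S f * L2_norm S g"
proof -
  let ?a = "(L2_norm S f)\<^sup>2" and ?b = "L2_inner S f g" and ?c = "(L2_norm S g)\<^sup>2"
  have quad: "0 \<le> ?a + 2 * t * ?b + t\<^sup>2 * ?c" for t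
    using L2_norm_square_add[OF f L2_scale[OF g, of t]]
      zero_le_power2[of "L2_norm S (\<lambda>z. f z + t * g z)"]
    by (simp add: L2_inner_scale_right L2_norm_scale power_mult_distrib mult.assoc)
  have "?b\<^sup>2 \<le> ?a * ?c"
  proof (cases "?c = 0")
    case True
    have "?b = 0"
    proof (rule ccontr)
      assume "?b \<noteq> 0"
      \<comment> \<open>At this \<open>t\<close> the quadratic, which is affine here, takes the
        value -1.\<close>
      then show False
        using quad[of "- (?a + 1) / (2 * ?b)"] True by (simp add: field_simps)
    qed
    then show ?thesis by simp
  next
    case False
    then have c: "?c > 0" by simp
    have "0 \<le> (?a + 2 * (- ?b / ?c) * ?b + (- ?b / ?c)\<^sup>2 * ?c) * ?c"
      using quad[of "- ?b / ?c"] c by (intro mult_nonneg_nonneg) auto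
    also have "\<dots> = ?a * ?c - ?b\<^sup>2"
      using False by (simp add: field_simps power2_eq_square)
    finally show ?thesis by simp
  qed
  then have "\<bar>?b\<bar>\<^sup>2 \<le> (L2_norm S f * L2_norm S g)\<^sup>2"
    by (simp add: power_mult_distrib)
  then show ?thesis
    by (rule power2_le_imp_le) (simp add: L2_norm_nonneg)
qed

section \<open>Triangle inequality and absolutely convergent series\<close>

lemma L2_norm_triangle:
  assumes "f \<in> L2 S" "g \<in> L2 S"
  shows "L2_norm S (\<lambda>z. f z + g z) \<le> L2_norm S f + L2_norm S g"
proof (rule power2_le_imp_le)
  have "L2_inner S f g \<le> L2_norm S f * L2_norm S g"
    using L2_inner_abs_le[OF assms] by simp
  then show "(L2_norm S (\<lambda>z. f z + g z))\<^sup>2 \<le> (L2_norm S f + L2_norm S g)\<^sup>2"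
    by (simp add: L2_norm_square_add[OF assms] power2_sum)
qed (simp add: L2_norm_nonneg)

lemma L2_norm_sum:
  assumes "finite A" "\<And>i. i \<in> A \<Longrightarrow> f i \<in> L2 S"
  shows "L2_norm S (\<lambda>z. \<Sum>i\<in>A. f i z) \<le> (\<Sum>i\<in>A. L2_norm S (f i))"
  using assms
proof (induction A rule: finite_induct)
  case empty
  then show ?case by (simp add: L2_norm_def)
next
  case (insert j A)
  then have "L2_norm S (\<lambda>z. f j z + (\<Sum>i\<in>A. f i z)) \<le> L2_norm S (f j) + L2_norm S (\<lambda>z. \<Sum>i\<in>A. f i z)"
    by (intro L2_norm_triangle L2_sum) auto
  with insert show ?case by auto
qed

text \<open>A weak form of completeness, tailored to the gliding hump argument. The partial sums of
  the absolute values are bounded in norm by the sum of the norms, so monotone convergence makes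
  their limit \<open>G\<close> finite almost everywhere and square integrable. Then
  \<open>\<bar>g\<bar> * G\<close> is an integrable majorant for the partial sums multiplied by
  \<open>g\<close>.\<close>

lemma L2_series:
  fixes f :: "nat \<Rightarrow> 'a::euclidean_space \<Rightarrow> real"
  assumes f: "\<And>n. f n \<in> L2 S" and sm: "summable (\<lambda>n. L2_norm S (f n))"
  obtains x where "x \<in> L2 S"
    and "\<And>g. g \<in> L2 S \<Longrightarrow> (\<lambda>n. L2_inner S g (f n)) sums L2_inner S g x"
proof -
  let ?M = "lebesgue_on S"
  define s where "s N z = (\<Sum>n<N. \<bar>f n z\<bar>)" for N z
  define x where "x z = (\<Sum>n. f n z)" for z
  define G where "G z = (\<Sum>n. \<bar>f n z\<bar>)" for z
  define C where "C = (\<Sum>n. L2_norm S (f n))"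
  have [measurable]: "f n \<in> borel_measurable ?M" for n using f L2_measurable by blast
  have [measurable]: "s N \<in> borel_measurable ?M" for N unfolding s_def by measurable
  have [measurable]: "G \<in> borel_measurable ?M" "x \<in> borel_measurable ?M"
    unfolding G_def x_def by measurable
  have sL2: "s N \<in> L2 S" for N unfolding s_def by (intro L2_sum L2_abs f)
  have abs_norm: "L2_norm S (\<lambda>z. \<bar>h z\<bar>) = L2_norm S h" for h by (simp add: L2_norm_def)
  have "L2_norm S (s N) \<le> C" for N
  proof -
    have "L2_norm S (s N) \<le> (\<Sum>n<N. L2_norm S (f n))"
      unfolding s_def using L2_norm_sum[of "{..<N}" "\<lambda>n z. \<bar>f n z\<bar>" S] f
      by (simp add: L2_abs abs_norm)
    also have "\<dots> \<le> C" unfolding C_def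
      by (rule sum_le_suminf[OF sm]) (auto simp: L2_norm_nonneg)
    finally show ?thesis .
  qed
  then have s_bound: "(LINT z|?M. (s N z)\<^sup>2) \<le> C\<^sup>2" for N
    unfolding L2_norm_square[symmetric] by (intro power_mono) (auto simp: L2_norm_nonneg)
  have s_nonneg: "0 \<le> s N z" for N z by (simp add: s_def sum_nonneg)
  have s_mono: "s M z \<le> s N z" if "M \<le> N" for M N z
    unfolding s_def using that by (intro sum_mono2) auto
  have inc: "mono (\<lambda>N. (s N z)\<^sup>2)" for z
    by (intro monoI power_mono s_mono s_nonneg)
  have "(\<integral>\<^sup>+ z. (SUP N. ennreal ((s N z)\<^sup>2)) \<partial>?M) = (SUP N. \<integral>\<^sup>+ z. ennreal ((s N z)\<^sup>2) \<partial>?M)"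
    by (rule nn_integral_monotone_convergence_SUP)
      (use inc in \<open>auto simp: incseq_def le_fun_def mono_def intro!: ennreal_leI\<close>)
  also have "\<dots> \<le> ennreal (C\<^sup>2)"
    by (rule SUP_least, subst nn_integral_eq_integral)
      (use sL2 s_bound in \<open>auto simp: L2_integrable_square intro!: ennreal_leI\<close>)
  finally have "(\<integral>\<^sup>+ z. (SUP N. ennreal ((s N z)\<^sup>2)) \<partial>?M) \<noteq> \<infinity>"
    by (auto simp: top_unique)
  then have "AE z in ?M. (SUP N. ennreal ((s N z)\<^sup>2)) \<noteq> \<infinity>"
    by (intro nn_integral_PInf_AE) auto
  then have summ: "AE z in ?M. summable (\<lambda>n. \<bar>f n z\<bar>)"
  proof eventually_elim
    case (elim z)
    then obtain D where D: "D \<ge> 0" "(SUP N. ennreal ((s N z)\<^sup>2)) = ennreal D"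
      by (cases "SUP N. ennreal ((s N z)\<^sup>2)") auto
    have "s N z \<le> sqrt D" for N
    proof -
      have "ennreal ((s N z)\<^sup>2) \<le> ennreal D" unfolding D(2)[symmetric] by (intro SUP_upper) auto
      then show ?thesis using D(1) by (simp add: real_le_rsqrt)
    qed
    then show ?case unfolding s_def by (intro summableI_nonneg_bounded) auto
  qed
  have s_lim: "AE z in ?M. (\<lambda>N. s N z) \<longlonglongrightarrow> G z"
    using summ by eventually_elim (simp add: s_def G_def summable_LIMSEQ)
  have mono_int: "(LINT z|?M. (s i z)\<^sup>2) \<le> (LINT z|?M. (s j z)\<^sup>2)" if "i \<le> j" for i j
    using that by (intro integral_mono L2_integrable_square sL2 monoD[OF inc])
  \<comment> \<open>The integrals increase and stay bounded, hence converge; monotone convergence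
    for real-valued integrals asks for this limit.\<close>
  have "Bseq (\<lambda>N. LINT z|?M. (s N z)\<^sup>2)"
    by (rule BseqI'[where K = "C\<^sup>2"]) (use s_bound in auto)
  then have "convergent (\<lambda>N. LINT z|?M. (s N z)\<^sup>2)"
    by (rule Bseq_mono_convergent) (use mono_int in blast)
  then obtain l where l: "(\<lambda>N. LINT z|?M. (s N z)\<^sup>2) \<longlonglongrightarrow> l" by (auto simp: convergent_def)
  have sq_lim: "AE z in ?M. (\<lambda>N. (s N z)\<^sup>2) \<longlonglongrightarrow> (G z)\<^sup>2"
    using s_lim by eventually_elim (rule tendsto_power)
  have "integrable ?M (\<lambda>z. (G z)\<^sup>2)"
  proof (rule integrable_monotone_convergence[OF L2_integrable_square[OF sL2] _ sq_lim l])
    show "AE z in ?M. mono (\<lambda>N. (s N z)\<^sup>2)" by (rule AE_I2, rule inc)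
    show "(\<lambda>z. (G z)\<^sup>2) \<in> borel_measurable ?M" by (rule borel_measurable_power) fact
  qed
  then have GL2: "G \<in> L2 S" by (simp add: L2_def)
  have xG: "AE z in ?M. \<bar>x z\<bar> \<le> G z"
    using summ by eventually_elim (simp add: x_def G_def summable_rabs)
  have xL2: "x \<in> L2 S"
  proof (rule L2_bound[OF _ L2_integrable_square[OF GL2]])
    show "AE z in ?M. (x z)\<^sup>2 \<le> (G z)\<^sup>2"
      using xG by eventually_elim (simp add: abs_le_square_iff[symmetric])
  qed fact
  show ?thesis
  proof (rule that[OF xL2])
    fix g assume g: "g \<in> L2 S"
    have [measurable]: "g \<in> borel_measurable ?M" using g L2_measurable by blast
    have "(\<lambda>N. LINT z|?M. g z * (\<Sum>n<N. f n z)) \<longlonglongrightarrow> (LINT z|?M. g z * x z)"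
    proof (rule integral_dominated_convergence)
      show "integrable ?M (\<lambda>z. \<bar>g z\<bar> * G z)" by (intro L2_integrable_mult L2_abs g GL2)
      show "AE z in ?M. (\<lambda>N. g z * (\<Sum>n<N. f n z)) \<longlonglongrightarrow> g z * x z"
        using summ by eventually_elim
          (auto simp: x_def intro!: tendsto_mult summable_LIMSEQ intro: summable_rabs_cancel)
      show "AE z in ?M. norm (g z * (\<Sum>n<N. f n z)) \<le> \<bar>g z\<bar> * G z" for N
        using summ
      proof eventually_elim
        case (elim z)
        have "\<bar>\<Sum>n<N. f n z\<bar> \<le> (\<Sum>n<N. \<bar>f n z\<bar>)" by (rule sum_abs)
        also have "\<dots> \<le> G z" unfolding G_def using elim by (intro sum_le_suminf) auto
        finally show ?case by (simp add: abs_mult mult_left_mono)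
      qed
    qed auto
    moreover have "(LINT z|?M. g z * (\<Sum>n<N. f n z)) = (\<Sum>n<N. L2_inner S g (f n))" for N
      by (simp add: L2_inner_def sum_distrib_left L2_integrable_mult[OF g f])
    ultimately show "(\<lambda>n. L2_inner S g (f n)) sums L2_inner S g x"
      by (simp add: sums_def L2_inner_def)
  qed
qed

section \<open>The uniform boundedness principle\<close>

text \<open>The signs are chosen one after the other so that the diagonal term never cancels.\<close>

lemma signs_exist:
  fixes b :: "nat \<Rightarrow> nat \<Rightarrow> real"
  obtains \<sigma> :: "nat \<Rightarrow> real" where "\<And>n. \<bar>\<sigma> n\<bar> = 1"
    and "\<And>n. \<bar>b n n\<bar> \<le> \<bar>\<Sum>m\<le>n. \<sigma> m * b n m\<bar>"
proof -
  let ?P = "\<lambda>(f::nat \<Rightarrow> real) n r. \<bar>r\<bar> = 1 \<and> \<bar>b n n\<bar> \<le> \<bar>(\<Sum>m<n. f m * b n m) + r * b n n\<bar>"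
  have "\<exists>f. \<forall>n. ?P f n (f n)"
  proof (rule dependent_wellorder_choice)
    fix f g :: "nat \<Rightarrow> real" and n r
    assume "\<And>m. m < n \<Longrightarrow> f m = g m"
    then have "(\<Sum>m<n. f m * b n m) = (\<Sum>m<n. g m * b n m)" by (intro sum.cong) auto
    then show "?P f n r = ?P g n r" by simp
  next
    fix n and f :: "nat \<Rightarrow> real"
    \<comment> \<open>The sign is chosen so that \<open>p\<close> and \<open>r * q\<close> do not
      have opposite signs; then their absolute values add up.\<close>
    have "\<exists>r::real. \<bar>r\<bar> = 1 \<and> \<bar>q\<bar> \<le> \<bar>p + r * q\<bar>" for p q
      by (cases "p * q \<ge> 0", rule exI[of _ 1], simp add: zero_le_mult_iff, linarith,
          rule exI[of _ "- 1"], simp add: not_le mult_less_0_iff, linarith)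
    then show "\<exists>r. ?P f n r" .
  qed
  then obtain \<sigma> where \<sigma>: "\<And>n. ?P \<sigma> n (\<sigma> n)" by blast
  show ?thesis
    by (rule that[of \<sigma>]) (use \<sigma> in \<open>auto simp: lessThan_Suc_atMost[symmetric]\<close>)
qed

text \<open>
  Gliding hump: if \<open>\<parallel>g n\<parallel> > 6\<^sup>n\<close>, then \<open>x = \<Sum>n. \<plusminus> 3\<^sup>-\<^sup>n g n / \<parallel>g n\<parallel>\<close> with suitable signs satisfies
  \<open>\<bar>\<langle>g n, x\<rangle>\<bar> \<ge> 3\<^sup>-\<^sup>n \<parallel>g n\<parallel> / 2\<close>, the terms beyond the \<open>n\<close>-th being too small to cancel the first ones.
\<close>

lemma L2_uniform_boundedness:
  fixes A :: "('a::euclidean_space \<Rightarrow> real) set"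
  assumes A: "A \<subseteq> L2 S"
    and pw: "\<And>p. p \<in> L2 S \<Longrightarrow> \<exists>C. \<forall>g\<in>A. \<bar>L2_inner S g p\<bar> \<le> C"
  shows "\<exists>C. \<forall>g\<in>A. L2_norm S g \<le> C"
proof (rule ccontr)
  assume "\<not> ?thesis"
  then have "\<forall>n::nat. \<exists>g\<in>A. L2_norm S g > 6 ^ n" by (meson not_le)
  then obtain g where g: "\<And>n. g n \<in> A" and big: "\<And>n. L2_norm S (g n) > 6 ^ n" by metis
  have gL2: "g n \<in> L2 S" for n using g A by auto
  let ?N = "\<lambda>n. L2_norm S (g n)"
  have pos: "?N n > 0" for n using big[of n] by (smt (verit) zero_less_power)
  define f where "f n z = (1 / ?N n) * g n z" for n z
  have fL2: "f n \<in> L2 S" for n unfolding f_def by (intro L2_scale gL2)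
  have fnorm: "L2_norm S (f n) = 1" for n
    unfolding f_def L2_norm_scale using pos[of n] by simp
  have gf: "L2_inner S (g n) (f n) = ?N n" for n
    using pos[of n] L2_inner_self[of S "g n"]
    unfolding f_def L2_inner_scale_right by (simp add: power2_eq_square)
  have gf_le: "\<bar>L2_inner S (g n) (f m)\<bar> \<le> ?N n" for n m
    using L2_inner_abs_le[OF gL2 fL2, of n m] fnorm by simp
  obtain \<sigma> where \<sigma>: "\<And>n. \<bar>\<sigma> n\<bar> = 1" and
    head: "\<And>n. \<bar>(1/3)^n * L2_inner S (g n) (f n)\<bar>
      \<le> \<bar>\<Sum>m\<le>n. \<sigma> m * ((1/3)^m * L2_inner S (g n) (f m))\<bar>"
    using signs_exist[of "\<lambda>n m. (1/3)^m * L2_inner S (g n) (f m)"] by blast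
  define c where "c n = \<sigma> n * (1/3)^n" for n
  have c: "\<bar>c n\<bar> = (1/3)^n" for n by (simp add: c_def abs_mult \<sigma>)
  obtain x where x: "x \<in> L2 S" and
    xs: "\<And>h. h \<in> L2 S \<Longrightarrow> (\<lambda>n. L2_inner S h (\<lambda>z. c n * f n z)) sums L2_inner S h x"
  proof (rule L2_series[of "\<lambda>n z. c n * f n z" S])
    show "(\<lambda>z. c n * f n z) \<in> L2 S" for n by (intro L2_scale fL2)
    show "summable (\<lambda>n. L2_norm S (\<lambda>z. c n * f n z))"
      by (simp add: L2_norm_scale c fnorm summable_geometric)
  qed blast
  have lower: "2 ^ n / 2 \<le> \<bar>L2_inner S (g n) x\<bar>" for n
  proof -
    let ?t = "\<lambda>m. c m * L2_inner S (g n) (f m)"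
    have sums: "?t sums L2_inner S (g n) x"
      using xs[OF gL2[of n]] by (simp add: L2_inner_scale_right)
    have "(\<lambda>m. ?t (m + Suc n)) sums (L2_inner S (g n) x - (\<Sum>m<Suc n. ?t m))"
      by (rule sums_split_initial_segment[OF sums])
    then have tail_eq: "L2_inner S (g n) x - (\<Sum>m\<le>n. ?t m) = (\<Sum>m. ?t (m + Suc n))"
      and tail_sum: "summable (\<lambda>m. ?t (m + Suc n))"
      by (auto simp: sums_iff lessThan_Suc_atMost)
    \<comment> \<open>The powers of 1/3 beyond the \<open>n\<close>-th sum to half of the
      \<open>n\<close>-th one, so the tail can cancel at most half of the lower bound for the
      head.\<close>
    have geo: "(\<lambda>m. (1/3)^(m + Suc n) * ?N n) sums ((1/3)^n * ?N n / 2)"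
    proof -
      have "(\<lambda>m. (1/3::real)^m) sums (3/2)" using geometric_sums[of "1/3::real"] by simp
      from sums_mult[OF this, of "(1/3)^Suc n * ?N n"] show ?thesis
        by (simp add: power_add mult_ac)
    qed
    have "\<bar>\<Sum>m. ?t (m + Suc n)\<bar> \<le> (\<Sum>m. (1/3)^(m + Suc n) * ?N n)"
    proof (rule order_trans[OF summable_rabs suminf_le])
      have le: "\<bar>?t (m + Suc n)\<bar> \<le> (1/3)^(m + Suc n) * ?N n" for m
        unfolding abs_mult c by (intro mult_left_mono gf_le) auto
      show "summable (\<lambda>m. \<bar>?t (m + Suc n)\<bar>)"
        by (rule summable_comparison_test'[OF sums_summable[OF geo], of 0]) (use le in auto)
      then show "summable (\<lambda>m. \<bar>?t (m + Suc n)\<bar>)" .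
      show "\<bar>?t (m + Suc n)\<bar> \<le> (1/3)^(m + Suc n) * ?N n" for m by (rule le)
      show "summable (\<lambda>m. (1/3)^(m + Suc n) * ?N n)" using geo sums_summable by blast
    qed
    also have "\<dots> = (1/3)^n * ?N n / 2" using geo by (simp add: sums_iff)
    finally have tail: "\<bar>L2_inner S (g n) x - (\<Sum>m\<le>n. ?t m)\<bar> \<le> (1/3)^n * ?N n / 2"
      by (simp add: tail_eq)
    have "(1/3)^n * ?N n \<le> \<bar>\<Sum>m\<le>n. ?t m\<bar>"
      using head[of n] pos[of n] by (simp add: gf c_def mult.assoc abs_mult)
    with tail have "(1/3)^n * ?N n / 2 \<le> \<bar>L2_inner S (g n) x\<bar>" by linarith
    \<comment> \<open>The growth \<open>6 ^ n\<close> of the norms outweighs the coefficients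
      \<open>(1/3)^n\<close> and leaves the unbounded factor \<open>2 ^ n\<close>.\<close>
    moreover have "(2::real)^n = (1/3)^n * 6 ^ n" by (simp add: power_mult_distrib[symmetric])
    moreover have "(1/3)^n * 6^n \<le> (1/3)^n * ?N n"
      using big[of n] by (intro mult_left_mono) auto
    ultimately show ?thesis by linarith
  qed
  obtain C where C: "\<forall>h\<in>A. \<bar>L2_inner S h x\<bar> \<le> C" using pw[OF x] by blast
  have "2 ^ n / 2 \<le> C" for n :: nat using C g[of n] lower[of n] by force
  moreover obtain n :: nat where "2 * C < 2 ^ n" using real_arch_pow[of 2 "2 * C"] by auto
  ultimately show False by (smt (verit) field_sum_of_halves)
qed

section \<open>The fundamental lemma of the calculus of variations\<close>

lemma Ck_SucD: "Ck (Suc n) f \<Longrightarrow> Ck n f"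
proof (induction n arbitrary: f)
  case 0
  then show ?case
    by (auto simp: continuous_on_eq_continuous_at intro: differentiable_imp_continuous_within)
next
  case (Suc n)
  then show ?case by (metis Ck.simps(2))
qed

lemma Ck_const: "Ck n (\<lambda>z::'a::euclidean_space. c)"
proof (induction n arbitrary: c)
  case (Suc n)
  then show ?case by (simp add: frechet_derivative_const)
qed simp

lemma Ck_add: "Ck n f \<Longrightarrow> Ck n g \<Longrightarrow> Ck n (\<lambda>z. f z + g z)"
proof (induction n arbitrary: f g)
  case 0
  then show ?case by (auto intro: continuous_on_add)
next
  case (Suc n)
  have "frechet_derivative (\<lambda>z. f z + g z) (at z)
      = (\<lambda>i. frechet_derivative f (at z) i + frechet_derivative g (at z) i)" for z
    by (rule frechet_derivative_at[symmetric])
      (use Suc.prems in \<open>auto intro!: has_derivative_add simp: frechet_derivative_works[symmetric]\<close>)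
  with Suc show ?case by auto
qed

lemma Ck_mult: "Ck n f \<Longrightarrow> Ck n g \<Longrightarrow> Ck n (\<lambda>z. f z * g z)"
proof (induction n arbitrary: f g)
  case 0
  then show ?case by (auto intro: continuous_on_mult)
next
  case (Suc n)
  have "frechet_derivative (\<lambda>z. f z * g z) (at z)
      = (\<lambda>i. f z * frechet_derivative g (at z) i + frechet_derivative f (at z) i * g z)" for z
    by (rule frechet_derivative_at[symmetric])
      (use Suc.prems in \<open>auto intro!: has_derivative_mult simp: frechet_derivative_works[symmetric]\<close>)
  \<comment> \<open>The derivative of a product also contains the undifferentiated factors, so these
    are needed at the lower order of smoothness.\<close>
  moreover have "Ck n f" "Ck n g" using Suc.prems Ck_SucD by blast+
  ultimately show ?case using Suc by (auto intro!: Ck_add)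
qed

lemma Ck_diff: "Ck n f \<Longrightarrow> Ck n g \<Longrightarrow> Ck n (\<lambda>z. f z - g z)"
  using Ck_add[of n f "\<lambda>z. - 1 * g z"] Ck_mult[OF Ck_const[of n "- 1"], of g] by simp

lemma Ck_power: "Ck n f \<Longrightarrow> Ck n (\<lambda>z. f z ^ m)"
  by (induction m) (auto intro: Ck_const Ck_mult)

lemma Ck_prod: "(\<And>i. i \<in> A \<Longrightarrow> Ck n (f i)) \<Longrightarrow> Ck n (\<lambda>z. \<Prod>i\<in>A. f i z)"
  by (induction A rule: infinite_finite_induct) (auto intro: Ck_const Ck_mult)

section \<open>A smooth bump that is positive exactly on an open box\<close>

definition flat :: "real poly \<Rightarrow> real \<Rightarrow> real" where
  "flat p x = (if x > 0 then poly p (1 / x) * exp (- (1 / x)) else 0)"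

text \<open>Substituting \<open>s = 1 / x\<close> turns the limit from the right into that of a
  polynomial over \<open>exp s\<close> at infinity; on the left the function vanishes.\<close>

lemma flat_tendsto_0: "(flat p \<longlongrightarrow> 0) (at 0)"
proof (rule filterlim_split_at)
  show "(flat p \<longlongrightarrow> 0) (at_left 0)"
    by (rule tendsto_eventually) (auto simp: eventually_at_filter flat_def)
  have "((\<lambda>s. \<Sum>i\<le>degree p. coeff p i * (s ^ i / exp s)) \<longlongrightarrow> (\<Sum>i\<le>degree p. coeff p i * 0)) at_top"
    by (intro tendsto_sum tendsto_mult tendsto_const tendsto_power_div_exp_0)
  moreover have "(\<Sum>i\<le>degree p. coeff p i * (s ^ i / exp s)) = poly p s / exp s" for s
    unfolding poly_altdef sum_divide_distrib by simp
  ultimately have "((\<lambda>s. poly p s / exp s) \<longlongrightarrow> 0) at_top" by simp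
  then have "((\<lambda>x. poly p (inverse x) / exp (inverse x)) \<longlongrightarrow> 0) (at_right 0)"
    by (rule filterlim_compose[OF _ filterlim_inverse_at_top_right])
  moreover have "eventually (\<lambda>x. poly p (inverse x) / exp (inverse x) = flat p x) (at_right 0)"
    unfolding eventually_at_filter
    by (rule always_eventually) (simp add: flat_def exp_minus inverse_eq_divide)
  ultimately show "(flat p \<longlongrightarrow> 0) (at_right 0)"
    using tendsto_cong by fastforce
qed

text \<open>Differentiating \<open>p(1/x) * exp(-1/x)\<close> produces the factor
  \<open>1/x^2\<close> times \<open>p - p'\<close> at \<open>1/x\<close>. The family
  \<open>flat p\<close> is thus closed under differentiation, which is the reason for indexing it by
  polynomials: smoothness then follows by induction.\<close>

definition flat_deriv :: "real poly \<Rightarrow> real poly" where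
  "flat_deriv p = monom 1 2 * (p - pderiv p)"

lemma flat_has_derivative: "(flat p has_field_derivative flat (flat_deriv p) x) (at x)"
proof (cases x "0::real" rule: linorder_cases)
  case less
  have "((\<lambda>x. 0) has_field_derivative 0) (at x)" by simp
  then have "(flat p has_field_derivative 0) (at x)"
    by (rule has_field_derivative_transform_within_open[of _ _ _ "{..<0}"])
      (use less in \<open>auto simp: flat_def\<close>)
  then show ?thesis using less by (simp add: flat_def)
next
  case equal
  \<comment> \<open>The difference quotient at the origin is again in the family, with
    \<open>p\<close> multiplied by the indeterminate, so its limit is already known. At
    \<open>h = 0\<close> both sides are 0, since division by zero yields 0.\<close>
  have eq: "flat (pCons 0 p) = (\<lambda>h. (flat p (0 + h) - flat p 0) / h)"
    by (rule ext) (simp add: flat_def)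
  have "((\<lambda>h. (flat p (0 + h) - flat p 0) / h) \<longlongrightarrow> 0) (at 0)"
    using flat_tendsto_0[of "pCons 0 p"] unfolding eq .
  moreover have "flat (flat_deriv p) 0 = 0" by (simp add: flat_def)
  ultimately show ?thesis unfolding equal DERIV_def by simp
next
  case greater
  have "((\<lambda>x. poly p (1 / x) * exp (- (1 / x))) has_field_derivative
      flat (flat_deriv p) x) (at x)"
  proof -
    have "((\<lambda>x. 1 / x) has_field_derivative - (1 / x\<^sup>2)) (at x)"
      using greater by (auto intro!: derivative_eq_intros simp: power2_eq_square)
    note d = this
    have "((\<lambda>x. poly p (1 / x)) has_field_derivative poly (pderiv p) (1 / x) * - (1 / x\<^sup>2)) (at x)"
      by (rule DERIV_chain2[OF poly_DERIV d])
    moreover have "((\<lambda>x. exp (- (1 / x))) has_field_derivative exp (- (1 / x)) * (1 / x\<^sup>2)) (at x)"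
      using DERIV_chain2[OF DERIV_exp DERIV_minus[OF d]] by simp
    ultimately have "((\<lambda>x. poly p (1 / x) * exp (- (1 / x))) has_field_derivative
        poly (pderiv p) (1 / x) * - (1 / x\<^sup>2) * exp (- (1 / x))
        + exp (- (1 / x)) * (1 / x\<^sup>2) * poly p (1 / x)) (at x)"
      by (rule DERIV_mult)
    moreover have "poly (pderiv p) (1 / x) * - (1 / x\<^sup>2) * exp (- (1 / x))
        + exp (- (1 / x)) * (1 / x\<^sup>2) * poly p (1 / x) = flat (flat_deriv p) x"
      using greater by (simp add: flat_def flat_deriv_def poly_monom power_one_over algebra_simps)
    ultimately show ?thesis by simp
  qed
  then show ?thesis
    by (rule has_field_derivative_transform_within_open[of _ _ _ "{0<..}"])
      (use greater in \<open>auto simp: flat_def\<close>)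
qed

text \<open>A partial derivative has the same form, with \<open>flat_deriv p\<close> scaled by the
  constant \<open>c * (i \<bullet> j)\<close> as its polynomial; hence the induction on
  \<open>n\<close> keeps \<open>p\<close> arbitrary.\<close>

lemma Ck_flat: "Ck n (\<lambda>z::'a::euclidean_space. flat p (c * (z \<bullet> j) + d))"
proof (induction n arbitrary: p)
  have der: "((\<lambda>z::'a. flat p (c * (z \<bullet> j) + d)) has_derivative
      (\<lambda>i. flat (flat_deriv p) (c * (z \<bullet> j) + d) * (c * (i \<bullet> j)))) (at z)" for z p
    by (rule has_derivative_compose[OF _ flat_has_derivative[unfolded has_field_derivative_def]])
      (auto intro!: derivative_eq_intros)
  {
    case 0
    show ?case
      using der by (auto simp: continuous_on_eq_continuous_at intro: has_derivative_continuous)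
  next
    case (Suc n)
    have "frechet_derivative (\<lambda>z::'a. flat p (c * (z \<bullet> j) + d)) (at z) i
        = flat (smult (c * (i \<bullet> j)) (flat_deriv p)) (c * (z \<bullet> j) + d)" for z i
      by (subst frechet_derivative_at[OF der, symmetric]) (simp add: flat_def)
    moreover have "(\<lambda>z::'a. flat p (c * (z \<bullet> j) + d)) differentiable (at z)" for z
      using der unfolding differentiable_def by blast
    ultimately show ?case using Suc by simp
  }
qed

definition box_bump :: "'a::euclidean_space \<Rightarrow> 'a \<Rightarrow> 'a \<Rightarrow> real" where
  "box_bump a b z = (\<Prod>j\<in>Basis. flat 1 (z \<bullet> j - a \<bullet> j) * flat 1 (b \<bullet> j - z \<bullet> j))"

lemma Ck_box_bump: "Ck n (box_bump a b)"
proof -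
  have "Ck n (\<lambda>z. flat 1 (z \<bullet> j - a \<bullet> j))" "Ck n (\<lambda>z. flat 1 (b \<bullet> j - z \<bullet> j))" for j :: 'a
    using Ck_flat[of n 1 1 j "- (a \<bullet> j)"] Ck_flat[of n 1 "- 1" j "b \<bullet> j"] by simp_all
  then show ?thesis
    unfolding box_bump_def by (intro Ck_prod Ck_mult) auto
qed

lemma box_bump_bounds:
  "0 \<le> box_bump a b z" "box_bump a b z \<le> 1" "box_bump a b z > 0 \<longleftrightarrow> z \<in> box a b"
proof -
  have nn: "0 \<le> flat 1 x" "flat 1 x \<le> 1" "flat 1 x > 0 \<longleftrightarrow> x > 0" for x by (auto simp: flat_def)
  show "0 \<le> box_bump a b z" unfolding box_bump_def by (intro prod_nonneg) (auto simp: nn)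
  show "box_bump a b z \<le> 1" unfolding box_bump_def by (intro prod_le_1) (auto simp: nn mult_le_one)
  show "box_bump a b z > 0 \<longleftrightarrow> z \<in> box a b"
  proof
    assume "box_bump a b z > 0"
    then have "box_bump a b z \<noteq> 0" by simp
    then have nz: "flat 1 (z \<bullet> j - a \<bullet> j) \<noteq> 0 \<and> flat 1 (b \<bullet> j - z \<bullet> j) \<noteq> 0" if "j \<in> Basis" for j
      unfolding box_bump_def using that by (simp add: prod_zero_iff)
    have "a \<bullet> j < z \<bullet> j \<and> z \<bullet> j < b \<bullet> j" if "j \<in> Basis" for j
      using nz[OF that] nn(1)[of "z \<bullet> j - a \<bullet> j"] nn(3)[of "z \<bullet> j - a \<bullet> j"]
        nn(1)[of "b \<bullet> j - z \<bullet> j"] nn(3)[of "b \<bullet> j - z \<bullet> j"] by linarith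
    then show "z \<in> box a b" by (simp add: mem_box)
  next
    assume "z \<in> box a b"
    then show "box_bump a b z > 0" unfolding box_bump_def
      by (intro prod_pos mult_pos_pos) (auto simp: box_def nn)
  qed
qed

section \<open>From test functions to indicators of boxes, and from these to null sets\<close>

text \<open>These test functions converge to the indicator function of the box.\<close>

lemma box_test_function:
  assumes "cbox a b \<subseteq> S"
  shows "(\<lambda>z. 1 - (1 - box_bump a b z) ^ n) \<in> test_functions S"
proof -
  have "{z. 1 - (1 - box_bump a b z) ^ n \<noteq> 0} \<subseteq> cbox a b"
  proof
    fix z assume "z \<in> {z. 1 - (1 - box_bump a b z) ^ n \<noteq> 0}"
    then have "box_bump a b z > 0" using box_bump_bounds(1)[of a b z] by (cases "box_bump a b z = 0") auto
    then show "z \<in> cbox a b" using box_bump_bounds(3)[of a b z] box_subset_cbox by blast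
  qed
  then have cl: "closure {z. 1 - (1 - box_bump a b z) ^ n \<noteq> 0} \<subseteq> cbox a b"
    by (rule closure_minimal) (rule closed_cbox)
  then have "compact (closure {z. 1 - (1 - box_bump a b z) ^ n \<noteq> 0})"
    by (meson closed_closure compact_cbox compact_Int_closed inf.absorb_iff2 compact_closure bounded_cbox bounded_subset closure_subset)
  with cl assms show ?thesis
    unfolding test_functions_def by (auto intro!: Ck_diff Ck_power Ck_const Ck_box_bump)
qed

text \<open>The functions \<open>1 - (1 - box_bump a b z) ^ n\<close> lie between 0 and the
  indicator of the open box and converge to it pointwise, so dominated convergence carries the
  orthogonality over to the indicator.\<close>

lemma integral_box_eq_0:
  fixes f :: "'a::euclidean_space \<Rightarrow> real"
  assumes S: "open S" and f: "f \<in> L2 S"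
    and orth: "\<And>\<phi>. \<phi> \<in> test_functions S \<Longrightarrow> (LINT z|lebesgue_on S. f z * \<phi> z) = 0"
    and ab: "cbox a b \<subseteq> S"
  shows "integrable (lebesgue_on S) (\<lambda>z. f z * indicator (box a b) z)"
    and "(LINT z|lebesgue_on S. f z * indicator (box a b) z) = 0"
proof -
  let ?M = "lebesgue_on S"
  let ?\<phi> = "\<lambda>n z. 1 - (1 - box_bump a b z) ^ n"
  have box: "box a b \<inter> S \<in> sets ?M"
    using S by (auto simp: sets_restrict_space intro!: image_eqI[of _ _ "box a b"])
  have ind: "(\<lambda>z. indicator (box a b) z :: real) \<in> borel_measurable ?M"
    by (intro measurable_restrict_space1 borel_measurable_indicator) auto
  have "emeasure ?M (box a b) < \<infinity>"
    using S ab box_subset_cbox[of a b]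
    by (subst emeasure_restrict_space) (auto simp: emeasure_lborel_box_eq)
  then have "integrable ?M (\<lambda>z. indicator (box a b) z :: real)"
    using box ab box_subset_cbox[of a b] S
    by (intro integrable_real_indicator) (auto simp: Int_absorb2 dest: subset_trans)
  then have iL2: "(\<lambda>z. indicator (box a b) z) \<in> L2 S"
    using ind by (simp add: L2_def power2_eq_square flip: indicator_inter_arith)
  show int: "integrable ?M (\<lambda>z. f z * indicator (box a b) z)"
    by (rule L2_integrable_mult[OF f iL2])
  have phi_meas: "?\<phi> n \<in> borel_measurable ?M" for n
  proof -
    have "continuous_on UNIV (?\<phi> n)"
      using box_test_function[OF ab, of n] Ck.simps(1) unfolding test_functions_def by blast
    then show ?thesis
      by (intro measurable_restrict_space1) (simp add: borel_measurable_continuous_onI measurable_completion)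
  qed
  have zero: "?\<phi> n z = 0" if "z \<notin> box a b" for n z
    using that box_bump_bounds[of a b z] by (metis diff_zero diff_self power_one less_eq_real_def)
  have lim: "(\<lambda>n. ?\<phi> n z) \<longlonglongrightarrow> indicator (box a b) z" for z
  proof (cases "z \<in> box a b")
    case True
    then have "(\<lambda>n. (1 - box_bump a b z) ^ n) \<longlonglongrightarrow> 0"
      using box_bump_bounds[of a b z] by (intro LIMSEQ_realpow_zero) auto
    from tendsto_diff[OF tendsto_const this, of 1] True show ?thesis by simp
  next
    case False
    then show ?thesis using zero by simp
  qed
  have "(\<lambda>n. LINT z|?M. f z * ?\<phi> n z) \<longlonglongrightarrow> (LINT z|?M. f z * indicator (box a b) z)"
  proof (rule integral_dominated_convergence)
    show "integrable ?M (\<lambda>z. \<bar>f z * indicator (box a b) z\<bar>)" using int by simp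
    show "AE z in ?M. (\<lambda>n. f z * ?\<phi> n z) \<longlonglongrightarrow> f z * indicator (box a b) z"
      by (intro AE_I2 tendsto_mult tendsto_const lim)
    have "\<bar>?\<phi> n z\<bar> \<le> indicator (box a b) z" for n z
    proof (cases "z \<in> box a b")
      case True
      have "0 \<le> (1 - box_bump a b z) ^ n" "(1 - box_bump a b z) ^ n \<le> 1"
        using box_bump_bounds[of a b z] by (auto intro!: power_le_one)
      then show ?thesis using True by simp
    qed (simp add: zero)
    then show "AE z in ?M. norm (f z * ?\<phi> n z) \<le> \<bar>f z * indicator (box a b) z\<bar>" for n
      by (intro AE_I2) (auto simp: abs_mult intro!: mult_left_mono)
  qed (use L2_measurable[OF f] ind phi_meas in \<open>auto intro!: borel_measurable_times\<close>)
  then show "(LINT z|?M. f z * indicator (box a b) z) = 0"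
    using orth[OF box_test_function[OF ab]] by (simp add: LIMSEQ_const_iff)
qed

text \<open>Inside a closed box contained in \<open>S\<close>, the integral of \<open>f\<close> over
  every open box vanishes. Open boxes are stable under intersection and generate the Borel sets, so
  the integral over every Borel set vanishes and \<open>f\<close> is zero almost everywhere there.
  Countably many such boxes cover \<open>S\<close>.\<close>

lemma fundamental_lemma:
  fixes f :: "'a::euclidean_space \<Rightarrow> real"
  assumes S: "open S" and f: "f \<in> L2 S"
    and orth: "\<And>\<phi>. \<phi> \<in> test_functions S \<Longrightarrow> (LINT z|lebesgue_on S. f z * \<phi> z) = 0"
  shows "AE z in lebesgue_on S. f z = 0"
proof -
  have Sl: "S \<inter> space lebesgue \<in> sets lebesgue" using S by auto
  have local_zero: "AE z in lebesgue. z \<in> box a b \<longrightarrow> f z = 0" if ab: "cbox a b \<subseteq> S" for a b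
  proof -
    have bS: "box a b \<subseteq> S" using ab box_subset_cbox by blast
    have bbox: "integrable lebesgue (\<lambda>z. indicator (box c d) z * f z)
        \<and> (LINT z|lebesgue. indicator (box c d) z * f z) = 0" if "cbox c d \<subseteq> S" for c d
    proof -
      have "box c d \<subseteq> S" using that box_subset_cbox by blast
      then have eq: "(\<lambda>z. indicator S z *\<^sub>R (f z * indicator (box c d) z))
          = (\<lambda>z. indicator (box c d) z * f z)"
        by (auto simp: indicator_def fun_eq_iff)
      show ?thesis
        using integral_box_eq_0[OF S f orth that]
        by (simp add: integrable_restrict_space[OF Sl] integral_restrict_space[OF Sl] eq
            del: real_scaleR_def)
    qed
    define F where "F z = indicator (box a b) z * f z" for z
    have Fint: "integrable lebesgue F" using bbox[OF ab] by (simp add: F_def[abs_def])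
    \<comment> \<open>Lebesgue measure is the completion of \<open>lborel\<close>; the Borel version
      \<open>h\<close> makes the argument on generators of the Borel sets available.\<close>
    obtain h where h: "h \<in> borel_measurable lborel" "AE z in lborel. F z = h z"
      using completion_ex_borel_measurable_real[OF borel_measurable_integrable[OF Fint]] by blast
    have hc: "h \<in> borel_measurable lebesgue" using h(1) by (rule measurable_completion)
    have Fh: "AE z in lebesgue. F z = h z" using h(2) by (rule AE_completion)
    have hint: "integrable lebesgue h"
      using integrable_cong_AE[OF borel_measurable_integrable[OF Fint] hc Fh] Fint by blast
    have hint': "integrable lborel h" using hint h(1) by (simp add: integrable_completion)
    have sb: "sets borel = sigma_sets UNIV (range (\<lambda>(c, d). box c d :: 'a set))"
      by (simp add: borel_eq_box)
    have Pow_UNIV_sub: "range (\<lambda>(c, d). box c d :: 'a set) \<subseteq> Pow UNIV" by simp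
    have "AE z in lborel. h z = 0"
    proof (rule sigma_finite_measure.density_zero[OF sigma_finite_lborel hint'])
      fix A :: "'a set" assume A: "A \<in> sets lborel"
      have eqAE: "(LINT z:B|lborel. h z) = (LINT z|lebesgue. indicator B z * F z)"
        if "B \<in> sets borel" for B
      proof -
        have "(LINT z:B|lborel. h z) = (LINT z|lebesgue. indicator B z * h z)"
          unfolding set_lebesgue_integral_def real_scaleR_def
          using h(1) that by (intro integral_completion[symmetric]) auto
        also have "\<dots> = (LINT z|lebesgue. indicator B z * F z)"
          by (rule integral_cong_AE)
            (use Fh hc that borel_measurable_integrable[OF Fint] in
              \<open>auto intro!: borel_measurable_times borel_measurable_indicator elim: AE_mp\<close>)
        finally show ?thesis .
      qed
      have si: "set_integrable lborel B h" if "B \<in> sets borel" for B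
        unfolding set_integrable_def using hint' that by (intro integrable_mult_indicator) auto
      have A': "A \<in> sigma_sets UNIV (range (\<lambda>(c, d). box c d))"
        using A sb by simp
      have stable: "Int_stable (range (\<lambda>(c, d). box c d :: 'a set))"
        by (auto simp: Int_stable_def box_Int_box)
      \<comment> \<open>Complements require the integral over the whole space. Since
        \<open>F\<close> vanishes outside \<open>box a b\<close>, this is again an integral over a
        box.\<close>
      have zero_UNIV: "(LINT z:UNIV|lborel. h z) = 0"
        using eqAE[of UNIV] bbox[OF ab] by (simp add: F_def)
      show "(LINT z:A|lborel. h z) = 0"
        using stable Pow_UNIV_sub A'
      proof (induction rule: sigma_sets_induct_disjoint)
        case (basic B)
        then obtain c d where B: "B = box c d" by auto
        \<comment> \<open>Both intersections must have the same corners: the open one carries the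
          integral, and the closed one lies in \<open>cbox a b\<close>, hence in
          \<open>S\<close>.\<close>
        obtain e g where eg: "box c d \<inter> box a b = box e g" "cbox c d \<inter> cbox a b = cbox e g"
          using box_Int_box[of c d a b] Int_interval[of c d a b] by blast
        have "cbox e g \<subseteq> S" using eg ab by blast
        moreover have "(\<lambda>z. indicator B z * F z) = (\<lambda>z. indicator (box e g) z * f z)"
          unfolding eg(1)[symmetric] B F_def by (auto simp: indicator_inter_arith)
        ultimately show ?case using eqAE[of B] bbox[of e g] B by simp
      next
        case empty
        then show ?case by (simp add: set_lebesgue_integral_def)
      next
        case (compl B)
        have Bb: "B \<in> sets borel" using compl(1) sb by simp
        have "(LINT z:B \<union> (UNIV - B)|lborel. h z)
            = (LINT z:B|lborel. h z) + (LINT z:UNIV - B|lborel. h z)"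
          using Bb by (intro set_integral_Un si) auto
        then show ?case using zero_UNIV compl by simp
      next
        case (union B)
        have Bb: "B i \<in> sets borel" for i
          using union(2) sb by auto
        have "(LINT z:\<Union>(range B)|lborel. h z) = (\<Sum>i. (LINT z:B i|lborel. h z))"
          by (rule lebesgue_integral_countable_add)
            (use Bb union(1) in \<open>auto simp: disjoint_family_on_def intro!: si\<close>)
        then show ?case using union by simp
      qed
    qed
    then have "AE z in lebesgue. h z = 0" by (rule AE_completion)
    with Fh show ?thesis by eventually_elim (auto simp: F_def)
  qed
  obtain \<D> where \<D>: "countable \<D>" "\<D> \<subseteq> Pow S" "\<And>X. X \<in> \<D> \<Longrightarrow> \<exists>a b. X = cbox a b" "\<Union>\<D> = S"
    using open_countable_Union_open_cbox[OF S] by metis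
  have "AE z in lebesgue. \<forall>X\<in>\<D>. z \<in> X \<longrightarrow> f z = 0"
  proof (subst AE_ball_countable[OF \<D>(1)], rule ballI)
    fix X assume X: "X \<in> \<D>"
    then obtain a b where ab: "X = cbox a b" using \<D>(3) by blast
    \<comment> \<open>The vanishing is known on open boxes, while the cover consists of closed ones;
      the faces in between are negligible.\<close>
    have "AE z in lebesgue. z \<notin> cbox a b - box a b"
      using negligible_frontier_interval[of a b] unfolding negligible_iff_null_sets by (rule AE_not_in)
    moreover have "AE z in lebesgue. z \<in> box a b \<longrightarrow> f z = 0"
      using X ab \<D>(2) by (intro local_zero) auto
    ultimately show "AE z in lebesgue. z \<in> X \<longrightarrow> f z = 0"
      unfolding ab by eventually_elim auto
  qed
  then have "AE z in lebesgue. z \<in> S \<longrightarrow> f z = 0"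
    unfolding \<D>(4)[symmetric] by eventually_elim auto
  then show ?thesis using Sl by (subst AE_restrict_space_iff) auto
qed

section \<open>Square integrability of test functions and their derivatives\<close>

lemma continuous_compact_support_L2:
  fixes f :: "'a::euclidean_space \<Rightarrow> real"
  assumes S: "S \<in> sets lebesgue" and f: "continuous_on UNIV f"
    and K: "compact K" "\<And>z. z \<notin> K \<Longrightarrow> f z = 0"
  shows "f \<in> L2 S"
proof -
  have "integrable lborel (\<lambda>z. indicator K z *\<^sub>R (f z)\<^sup>2)"
    by (rule borel_integrable_compact[OF K(1)])
      (auto intro!: continuous_on_power continuous_on_subset[OF f])
  moreover have "(\<lambda>z. indicator K z *\<^sub>R (f z)\<^sup>2) = (\<lambda>z. (f z)\<^sup>2)"
    using K(2) by (auto simp: indicator_def fun_eq_iff)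
  ultimately have "integrable lebesgue (\<lambda>z. (f z)\<^sup>2)"
    using f by (simp add: integrable_completion borel_measurable_continuous_onI)
  then have "integrable (lebesgue_on S) (\<lambda>z. (f z)\<^sup>2)"
    using S by (subst integrable_restrict_space) (auto intro: integrable_mult_indicator simp del: real_scaleR_def)
  moreover have "f \<in> borel_measurable (lebesgue_on S)"
    using f by (intro measurable_restrict_space1) (simp add: borel_measurable_continuous_onI measurable_completion)
  ultimately show ?thesis by (simp add: L2_def)
qed

text \<open>This provides the integrability needed to split integrals against test functions. Off
  the closed support the function is zero on an open set, so its derivative is zero there too, and
  both are continuous with compact support.\<close>

lemma test_function_L2:
  assumes S: "open S" and \<phi>: "\<phi> \<in> test_functions S"
  shows "\<phi> \<in> L2 S" and "i \<in> Basis \<Longrightarrow> (\<lambda>z. frechet_derivative \<phi> (at z) i) \<in> L2 S"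
proof -
  let ?K = "closure {z. \<phi> z \<noteq> 0}"
  have K: "compact ?K" and Ck: "\<And>n. Ck n \<phi>" using \<phi> by (auto simp: test_functions_def)
  have Sl: "S \<in> sets lebesgue" using S by simp
  have z: "\<phi> z = 0" if "z \<notin> ?K" for z using that closure_subset[of "{z. \<phi> z \<noteq> 0}"] by auto
  show "\<phi> \<in> L2 S"
    using Ck[of 0] by (intro continuous_compact_support_L2[OF Sl _ K z]) auto
  assume i: "i \<in> Basis"
  have "frechet_derivative \<phi> (at w) i = 0" if w: "w \<notin> ?K" for w
  proof -
    have "((\<lambda>z. 0) has_derivative (\<lambda>i. 0)) (at w)" by simp
    then have "(\<phi> has_derivative (\<lambda>i. 0)) (at w)"
    proof (rule has_derivative_transform_within_open[where s = "- ?K"])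
      show "w \<in> - ?K" using w by simp
      show "0 = \<phi> x" if "x \<in> - ?K" for x using z[of x] that by (metis ComplD)
    qed auto
    then have "(\<lambda>i. 0) = frechet_derivative \<phi> (at w)" by (rule frechet_derivative_at)
    then show ?thesis by (metis (mono_tags))
  qed
  moreover have "continuous_on UNIV (\<lambda>z. frechet_derivative \<phi> (at z) i)"
    using Ck[of "Suc 0"] i by simp
  ultimately show "(\<lambda>z. frechet_derivative \<phi> (at z) i) \<in> L2 S"
    by (intro continuous_compact_support_L2[OF Sl _ K]) blast+
qed

section \<open>Weak derivatives and the bilinear form of the beam equation\<close>

lemma is_weak_derivD:
  assumes "is_weak_deriv S i f g"
  shows "f \<in> L2 S" and "g \<in> L2 S"
    and "\<phi> \<in> test_functions S \<Longrightarrow> (LINT z|lebesgue_on S. f z * frechet_derivative \<phi> (at z) i)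
      = - (LINT z|lebesgue_on S. g z * \<phi> z)"
  using assms by (auto simp: is_weak_deriv_def)

lemma is_weak_deriv_diff:
  assumes S: "open S" "i \<in> Basis"
    and f: "is_weak_deriv S i f g" and f': "is_weak_deriv S i f' g'"
  shows "is_weak_deriv S i (\<lambda>z. f z - f' z) (\<lambda>z. g z - g' z)"
  unfolding is_weak_deriv_def
proof (intro conjI ballI)
  show "(\<lambda>z. f z - f' z) \<in> L2 S" "(\<lambda>z. g z - g' z) \<in> L2 S"
    using is_weak_derivD[OF f] is_weak_derivD[OF f'] by (auto intro: L2_diff)
  fix \<phi> assume \<phi>: "\<phi> \<in> test_functions S"
  note test = test_function_L2(1)[OF S(1) \<phi>] test_function_L2(2)[OF S(1) \<phi> S(2)]
  show "(LINT z|lebesgue_on S. (f z - f' z) * frechet_derivative \<phi> (at z) i)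
      = - (LINT z|lebesgue_on S. (g z - g' z) * \<phi> z)"
    using L2_inner_diff_left[OF is_weak_derivD(1)[OF f] is_weak_derivD(1)[OF f'] test(2)]
      L2_inner_diff_left[OF is_weak_derivD(2)[OF f] is_weak_derivD(2)[OF f'] test(1)]
      is_weak_derivD(3)[OF f \<phi>] is_weak_derivD(3)[OF f' \<phi>]
    unfolding L2_inner_def by linarith
qed

text \<open>Changing a function on a null set alters no integral against a test function. This is
  needed because \<open>Dxx\<close> differentiates a chosen version of \<open>Dx\<close>, and the
  version chosen for a difference agrees with the difference of the versions only almost
  everywhere.\<close>

lemma is_weak_deriv_cong_AE:
  assumes S: "open S" "i \<in> Basis"
    and f: "is_weak_deriv S i f g" and f': "f' \<in> L2 S"
    and eq: "AE z in lebesgue_on S. f z = f' z"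
  shows "is_weak_deriv S i f' g"
  unfolding is_weak_deriv_def
proof (intro conjI ballI f' is_weak_derivD(2)[OF f])
  fix \<phi> assume \<phi>: "\<phi> \<in> test_functions S"
  have "(LINT z|lebesgue_on S. f' z * frechet_derivative \<phi> (at z) i)
      = (LINT z|lebesgue_on S. f z * frechet_derivative \<phi> (at z) i)"
  proof (rule integral_cong_AE)
    show "(\<lambda>z. f' z * frechet_derivative \<phi> (at z) i) \<in> borel_measurable (lebesgue_on S)"
      "(\<lambda>z. f z * frechet_derivative \<phi> (at z) i) \<in> borel_measurable (lebesgue_on S)"
      by (intro borel_measurable_times L2_measurable f' is_weak_derivD(1)[OF f]
          test_function_L2(2)[OF S(1) \<phi> S(2)])+
    show "AE z in lebesgue_on S.
        f' z * frechet_derivative \<phi> (at z) i = f z * frechet_derivative \<phi> (at z) i"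
      using eq by eventually_elim simp
  qed
  then show "(LINT z|lebesgue_on S. f' z * frechet_derivative \<phi> (at z) i)
      = - (LINT z|lebesgue_on S. g z * \<phi> z)"
    using is_weak_derivD(3)[OF f \<phi>] by simp
qed

text \<open>The difference of two weak derivatives is orthogonal to all test functions, so the
  fundamental lemma applies to it.\<close>

lemma is_weak_deriv_unique:
  assumes S: "open S" and g: "is_weak_deriv S i f g" and g': "is_weak_deriv S i f g'"
  shows "AE z in lebesgue_on S. g z = g' z"
proof -
  note L = is_weak_derivD(2)[OF g] is_weak_derivD(2)[OF g']
  have "AE z in lebesgue_on S. g z - g' z = 0"
  proof (rule fundamental_lemma[OF S L2_diff[OF L]])
    fix \<phi> assume \<phi>: "\<phi> \<in> test_functions S"
    show "(LINT z|lebesgue_on S. (g z - g' z) * \<phi> z) = 0"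
      using L2_inner_diff_left[OF L test_function_L2(1)[OF S \<phi>]]
        is_weak_derivD(3)[OF g \<phi>] is_weak_derivD(3)[OF g' \<phi>]
      unfolding L2_inner_def by linarith
  qed
  then show ?thesis by eventually_elim simp
qed

lemma wderiv: "weakly_diff S i f \<Longrightarrow> is_weak_deriv S i f (wderiv S i f)"
  unfolding weakly_diff_def wderiv_def by (rule someI_ex[of "is_weak_deriv S i f"])

lemma wderiv_AE_eq:
  assumes "open S" "is_weak_deriv S i f g"
  shows "AE z in lebesgue_on S. wderiv S i f z = g z"
  using assms by (intro is_weak_deriv_unique[OF _ wderiv]) (auto simp: weakly_diff_def)

section \<open>Differences in the anisotropic space on the rectangle\<close>

lemma open_Omega: "open (Omega L T)"
  by (simp add: Omega_def open_Times)

lemma Basis_time: "(0, 1) \<in> (Basis :: (real \<times> real) set)"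
  and Basis_space: "(1, 0) \<in> (Basis :: (real \<times> real) set)"
  by (simp_all add: Basis_prod_def)

lemma H21_L2:
  assumes "f \<in> H21 L T"
  shows "f \<in> L2 (Omega L T)" "Dt L T f \<in> L2 (Omega L T)" "Dxx L T f \<in> L2 (Omega L T)"
  using assms is_weak_derivD(2)[OF wderiv] by (auto simp: H21_def Dt_def Dx_def Dxx_def)

text \<open>The operators \<open>Dt\<close> and \<open>Dxx\<close> pick arbitrary versions, so their
  linearity is asserted almost everywhere; it comes from uniqueness of weak derivatives.\<close>

lemma H21_diff:
  assumes f: "f \<in> H21 L T" and g: "g \<in> H21 L T"
  shows "(\<lambda>z. f z - g z) \<in> H21 L T"
    and "AE z in lebesgue_on (Omega L T). Dt L T (\<lambda>z. f z - g z) z = Dt L T f z - Dt L T g z"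
    and "AE z in lebesgue_on (Omega L T). Dxx L T (\<lambda>z. f z - g z) z = Dxx L T f z - Dxx L T g z"
proof -
  let ?S = "Omega L T" and ?h = "\<lambda>z. f z - g z"
  have t: "is_weak_deriv ?S (0, 1) ?h (\<lambda>z. Dt L T f z - Dt L T g z)"
    using f g unfolding H21_def Dt_def
    by (auto intro!: is_weak_deriv_diff[OF open_Omega Basis_time] wderiv)
  have x: "is_weak_deriv ?S (1, 0) ?h (\<lambda>z. Dx L T f z - Dx L T g z)"
    using f g unfolding H21_def Dx_def
    by (auto intro!: is_weak_deriv_diff[OF open_Omega Basis_space] wderiv)
  then have wx: "weakly_diff ?S (1, 0) ?h" by (auto simp: weakly_diff_def)
  have eqx: "AE z in lebesgue_on ?S. Dx L T f z - Dx L T g z = Dx L T ?h z"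
    using wderiv_AE_eq[OF open_Omega x] unfolding Dx_def by eventually_elim simp
  have "is_weak_deriv ?S (1, 0) (\<lambda>z. Dx L T f z - Dx L T g z) (\<lambda>z. Dxx L T f z - Dxx L T g z)"
    using f g unfolding H21_def Dxx_def Dx_def
    by (auto intro!: is_weak_deriv_diff[OF open_Omega Basis_space] wderiv)
  moreover have "Dx L T ?h \<in> L2 ?S"
    using is_weak_derivD(2)[OF wderiv[OF wx]] by (simp add: Dx_def)
  ultimately have xx: "is_weak_deriv ?S (1, 0) (Dx L T ?h) (\<lambda>z. Dxx L T f z - Dxx L T g z)"
    using is_weak_deriv_cong_AE[OF open_Omega Basis_space _ _ eqx] by blast
  show "?h \<in> H21 L T"
    using f g t wx xx unfolding H21_def weakly_diff_def by (auto intro: L2_diff)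
  show "AE z in lebesgue_on ?S. Dt L T ?h z = Dt L T f z - Dt L T g z"
    unfolding Dt_def[of L T ?h] by (rule wderiv_AE_eq[OF open_Omega t])
  show "AE z in lebesgue_on ?S. Dxx L T ?h z = Dxx L T f z - Dxx L T g z"
    unfolding Dxx_def[of L T ?h] Dx_def[of L T "Dx L T ?h"] by (rule wderiv_AE_eq[OF open_Omega xx])
qed

lemma H21_hat_diff:
  assumes "f \<in> H21_hat L T" "g \<in> H21_hat L T"
  shows "(\<lambda>z. f z - g z) \<in> H21_hat L T"
  using assms unfolding H21_hat_def by (auto intro: H21_diff(1) continuous_on_diff)

section \<open>Coefficients that depend on the space variable only\<close>

lemma fst_null_lborel:
  assumes "N \<in> null_sets (lborel :: 'a::euclidean_space measure)"
  shows "fst -` N \<in> null_sets (lborel :: ('a \<times> 'b::euclidean_space) measure)"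
proof -
  have "N \<times> (UNIV :: 'b set) \<in> null_sets (lborel \<Otimes>\<^sub>M lborel)"
    using assms by (intro lborel.times_in_null_sets1) auto
  then show ?thesis by (simp add: lborel_prod fst_vimage_eq_Times)
qed

text \<open>For a completed measure on the target, Borel measurability does not suffice: preimages
  of null sets must be null as well. Here they are cylinders over null sets.\<close>

lemma fst_measurable_lebesgue:
  "fst \<in> measurable (lebesgue :: ('a::euclidean_space \<times> 'b::euclidean_space) measure) lebesgue"
proof (rule completion.measurable_completion2)
  show m: "fst \<in> measurable (lebesgue :: ('a \<times> 'b) measure) lborel"
    by (rule measurable_completion) (simp add: borel_measurable_continuous_onI continuous_on_fst)
  show "null_sets (lborel :: 'a measure) \<subseteq> null_sets (distr (lebesgue :: ('a \<times> 'b) measure) lborel fst)"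
  proof
    fix N :: "'a set" assume N: "N \<in> null_sets lborel"
    then have "fst -` N \<in> null_sets (lebesgue :: ('a \<times> 'b) measure)"
      by (intro null_sets_completionI fst_null_lborel)
    then show "N \<in> null_sets (distr (lebesgue :: ('a \<times> 'b) measure) lborel fst)"
      using N null_setsD2[OF N] by (simp add: null_sets_distr_iff[OF m])
  qed
qed

lemma AE_fst_lebesgue:
  assumes "AE x in (lebesgue :: 'a::euclidean_space measure). P x"
  shows "AE z in (lebesgue :: ('a \<times> 'b::euclidean_space) measure). P (fst z)"
proof -
  obtain N where N: "N \<in> null_sets (lebesgue :: 'a measure)" "{x. \<not> P x} \<subseteq> N"
    using assms by (auto simp: eventually_ae_filter)
  then obtain N' where N': "N' \<in> null_sets lborel" "N \<subseteq> N'"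
    by (auto simp: null_sets_completion_iff2)
  have "fst -` N' \<in> null_sets (lebesgue :: ('a \<times> 'b) measure)"
    using fst_null_lborel[OF N'(1)] by (rule null_sets_completionI)
  then show ?thesis
    by (rule AE_I') (use N(2) N'(2) in auto)
qed

lemma Linf_fst:
  fixes A :: "'a::euclidean_space set" and B :: "'b::euclidean_space set"
  assumes A: "A \<in> sets lebesgue" and AB: "A \<times> B \<in> sets lebesgue" and k: "k \<in> Linf A"
  shows "(\<lambda>z. k (fst z)) \<in> Linf (A \<times> B)"
proof -
  from k obtain C where km: "k \<in> borel_measurable (lebesgue_on A)"
    and kC: "AE x in lebesgue_on A. \<bar>k x\<bar> \<le> C" by (auto simp: Linf_def)
  \<comment> \<open>Extension by zero gives a measurable function on the whole space, which can be
    composed with the projection and agrees with \<open>k\<close> over \<open>A\<close>.\<close>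
  have "(\<lambda>x. if x \<in> A then k x else 0) \<in> borel_measurable lebesgue"
    using km A borel_measurable_if by blast
  from measurable_compose[OF fst_measurable_lebesgue this]
  have m: "(\<lambda>z::'a \<times> 'b. if fst z \<in> A then k (fst z) else 0) \<in> borel_measurable (lebesgue_on (A \<times> B))"
    by (rule measurable_restrict_space1)
  have "(\<lambda>z. k (fst z)) \<in> borel_measurable (lebesgue_on (A \<times> B))"
    by (rule measurable_cong[THEN iffD1, OF _ m]) auto
  moreover have "AE x in lebesgue. x \<in> A \<longrightarrow> \<bar>k x\<bar> \<le> C"
    using kC A by (subst (asm) AE_restrict_space_iff) auto
  then have "AE z in (lebesgue :: ('a \<times> 'b) measure). fst z \<in> A \<longrightarrow> \<bar>k (fst z)\<bar> \<le> C"
    by (rule AE_fst_lebesgue)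
  then have "AE z in (lebesgue :: ('a \<times> 'b) measure). z \<in> A \<times> B \<longrightarrow> \<bar>k (fst z)\<bar> \<le> C"
    by eventually_elim auto
  then have "AE z in lebesgue_on (A \<times> B). \<bar>k (fst z)\<bar> \<le> C"
    using AB by (subst AE_restrict_space_iff) auto
  ultimately show ?thesis by (auto simp: Linf_def)
qed

lemma Linf_mult_L2:
  assumes k: "k \<in> Linf S" and f: "f \<in> L2 S"
  shows "(\<lambda>z. k z * f z) \<in> L2 S"
proof -
  from k obtain C where km: "k \<in> borel_measurable (lebesgue_on S)"
    and kC: "AE x in lebesgue_on S. \<bar>k x\<bar> \<le> C" by (auto simp: Linf_def)
  have "integrable (lebesgue_on S) (\<lambda>z. C\<^sup>2 * (f z)\<^sup>2)"
    using L2_integrable_square[OF f] by simp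
  then show ?thesis
  proof (rule L2_bound[rotated])
    show "(\<lambda>z. k z * f z) \<in> borel_measurable (lebesgue_on S)"
      by (intro borel_measurable_times km L2_measurable f)
    show "AE z in lebesgue_on S. (k z * f z)\<^sup>2 \<le> C\<^sup>2 * (f z)\<^sup>2"
      using kC
    proof eventually_elim
      case (elim z)
      then have "(k z)\<^sup>2 \<le> C\<^sup>2" using power_mono[of "\<bar>k z\<bar>" C 2] by simp
      then show ?case by (simp add: power_mult_distrib mult_right_mono)
    qed
  qed
qed

section \<open>The bilinear form common to the state and the adjoint equation\<close>

definition beam_form ::
    "real \<Rightarrow> real \<Rightarrow> (real \<Rightarrow> real) \<Rightarrow> (real \<times> real \<Rightarrow> real) \<Rightarrow> (real \<times> real \<Rightarrow> real) \<Rightarrow> real" where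
  "beam_form L T k f g = (LINT z|lebesgue_on (Omega L T).
     - Dt L T f z * Dt L T g z + k (fst z) * Dxx L T f z * Dxx L T g z)"

text \<open>Symmetry lets the state equation tested with an adjoint solution be compared with the
  adjoint equation tested with a difference of states.\<close>

lemma beam_form_commute: "beam_form L T k f g = beam_form L T k g f"
  by (simp add: beam_form_def mult_ac)

text \<open>Boundedness of \<open>k\<close> keeps \<open>k * Dxx f\<close> square integrable, so
  both summands are products of square-integrable functions.\<close>

lemma beam_form_integrable:
  assumes k: "k \<in> Linf {0<..<L}" and f: "f \<in> H21 L T" and g: "g \<in> H21 L T"
  shows "integrable (lebesgue_on (Omega L T))
      (\<lambda>z. - Dt L T f z * Dt L T g z + k (fst z) * Dxx L T f z * Dxx L T g z)"
proof -
  have "(\<lambda>z. k (fst z)) \<in> Linf (Omega L T)"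
    unfolding Omega_def using k by (intro Linf_fst) (auto simp: open_Times)
  from Linf_mult_L2[OF this H21_L2(3)[OF f]]
  have "integrable (lebesgue_on (Omega L T)) (\<lambda>z. k (fst z) * Dxx L T f z * Dxx L T g z)"
    by (rule L2_integrable_mult) (rule H21_L2(3)[OF g])
  moreover have "integrable (lebesgue_on (Omega L T)) (\<lambda>z. - (Dt L T f z * Dt L T g z))"
    using L2_integrable_mult[OF H21_L2(2)[OF f] H21_L2(2)[OF g]] by simp
  ultimately show ?thesis by simp
qed

lemma beam_form_diff_left:
  assumes k: "k \<in> Linf {0<..<L}" and f: "f \<in> H21 L T" and f': "f' \<in> H21 L T" and g: "g \<in> H21 L T"
  shows "beam_form L T k (\<lambda>z. f z - f' z) g = beam_form L T k f g - beam_form L T k f' g"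
proof -
  let ?M = "lebesgue_on (Omega L T)" and ?h = "\<lambda>z. f z - f' z"
  let ?b = "\<lambda>f z. - Dt L T f z * Dt L T g z + k (fst z) * Dxx L T f z * Dxx L T g z"
  note int = beam_form_integrable[OF k _ g]
  have "beam_form L T k ?h g = (LINT z|?M. ?b f z - ?b f' z)"
    unfolding beam_form_def
  proof (rule integral_cong_AE)
    show "?b ?h \<in> borel_measurable ?M"
      by (rule borel_measurable_integrable[OF int[OF H21_diff(1)[OF f f']]])
    show "(\<lambda>z. ?b f z - ?b f' z) \<in> borel_measurable ?M"
      by (intro borel_measurable_diff borel_measurable_integrable int f f')
    show "AE z in ?M. ?b ?h z = ?b f z - ?b f' z"
      using H21_diff(2,3)[OF f f']
    proof eventually_elim
      case (elim z)
      then show ?case by (simp only: elim) (simp add: algebra_simps)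
    qed
  qed
  also have "\<dots> = beam_form L T k f g - beam_form L T k f' g"
    unfolding beam_form_def by (rule Bochner_Integration.integral_diff[OF int[OF f] int[OF f']])
  finally show ?thesis .
qed

text \<open>The points of \<open>S\<close> where \<open>f\<close> is nonzero form an open null set,
  which must be empty. This turns the initial condition, given almost everywhere, into the pointwise
  one required of test functions.\<close>

lemma continuous_AE_zero:
  fixes f :: "'a::euclidean_space \<Rightarrow> real"
  assumes S: "open S" and f: "continuous_on S f" and ae: "AE x in lebesgue_on S. f x = 0"
    and x: "x \<in> S"
  shows "f x = 0"
proof (rule ccontr)
  assume nz: "f x \<noteq> 0"
  have op: "open (S \<inter> f -` (- {0}))"
    using f S by (metis continuous_on_open_vimage inf_commute open_Compl closed_singleton open_Int)
  have "AE x in lebesgue. x \<in> S \<longrightarrow> f x = 0"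
    using ae S by (subst (asm) AE_restrict_space_iff) auto
  then have "{x. \<not> (x \<in> S \<longrightarrow> f x = 0)} \<in> null_sets lebesgue"
    by (simp add: completion.AE_iff_null_sets)
  moreover have "{x. \<not> (x \<in> S \<longrightarrow> f x = 0)} = S \<inter> f -` (- {0})" by auto
  ultimately have "negligible (S \<inter> f -` (- {0}))" by (simp add: negligible_iff_null_sets)
  then show False using open_not_negligible[OF op] x nz by auto
qed

text \<open>Continuity up to the sides of the rectangle makes the trace continuous on the compact
  interval \<open>{0..L}\<close>.\<close>

lemma H21_hat_trace_L2:
  assumes L: "L > 0" and T: "T > 0" and f: "f \<in> H21_hat L T"
  shows "(\<lambda>x. f (x, 0)) \<in> L2 {0<..<L}"
proof -
  have c: "continuous_on {0..L} (\<lambda>x. f (x, 0))"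
    using f T unfolding H21_hat_def
    by (auto intro!: continuous_on_compose2[of "{0..L} \<times> {0..T}" f] continuous_intros)
  then have "(\<lambda>x. (f (x, 0))\<^sup>2) absolutely_integrable_on {0..L}"
    by (intro absolutely_integrable_continuous_real continuous_intros)
  then have "(\<lambda>x. (f (x, 0))\<^sup>2) absolutely_integrable_on {0<..<L}"
    by (rule set_integrable_subset) auto
  then have "integrable (lebesgue_on {0<..<L}) (\<lambda>x. (f (x, 0))\<^sup>2)"
    by (simp add: set_integrable_def integrable_restrict_space)
  moreover have "(\<lambda>x. f (x, 0)) \<in> borel_measurable (lebesgue_on {0<..<L})"
    by (rule continuous_imp_measurable_on_sets_lebesgue)
      (use c in \<open>auto intro: continuous_on_subset\<close>)
  ultimately show ?thesis by (simp add: L2_def)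
qed

section \<open>Differentiability of the cost functional\<close>

lemma beam_weak_solution_form:
  assumes "beam_weak_solution L T k w v F u" and "\<eta> \<in> H21_hat L T"
    and "\<And>x. x \<in> {0<..<L} \<Longrightarrow> \<eta> (x, T) = 0"
  shows "beam_form L T k u \<eta>
    = L2_inner (Omega L T) \<eta> F + L2_inner {0<..<L} v (\<lambda>x. \<eta> (x, 0))"
  unfolding beam_form_def L2_inner_def
  by (rule assms(1)[unfolded beam_weak_solution_def, THEN conjunct2, THEN conjunct2,
        THEN bspec, OF assms(2), THEN mp]) (use assms(3) in simp)

lemma adjoint_weak_solution_form:
  assumes "adjoint_weak_solution L T k y u \<psi>" and "\<eta> \<in> H21_hat L T"
    and "\<And>x. x \<in> {0<..<L} \<Longrightarrow> \<eta> (x, 0) = 0"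
  shows "beam_form L T k \<psi> \<eta> = - 2 * L2_inner (Omega L T) (\<lambda>z. u z - y z) \<eta>"
  unfolding beam_form_def L2_inner_def
  by (rule assms(1)[unfolded adjoint_weak_solution_def, THEN conjunct2, THEN conjunct2,
        THEN bspec, OF assms(2), THEN mp]) (use assms(3) in simp)

text \<open>Since \<open>\<psi>\<close> vanishes at time \<open>T\<close> and a difference of states
  vanishes at time 0, each is an admissible test function in the equation of the other. Subtracting
  the two state equations removes \<open>F\<close>, and symmetry of the form identifies the
  left-hand sides.\<close>

lemma state_adjoint_duality:
  assumes L: "L > 0" and T: "T > 0" and k: "k \<in> Linf {0<..<L}"
    and y: "y \<in> L2 (Omega L T)" and a: "a \<in> L2 {0<..<L}" and b: "b \<in> L2 {0<..<L}"
    and ua: "beam_weak_solution L T k w a F ua" and ub: "beam_weak_solution L T k w b F ub"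
    and \<psi>: "adjoint_weak_solution L T k y uc \<psi>"
  shows "2 * L2_inner (Omega L T) (\<lambda>z. uc z - y z) (\<lambda>z. ua z - ub z)
    = - L2_inner {0<..<L} (\<lambda>x. \<psi> (x, 0)) (\<lambda>x. a x - b x)"
proof -
  let ?\<eta> = "\<lambda>z. ua z - ub z" and ?g = "\<lambda>x. \<psi> (x, 0)"
  have uah: "ua \<in> H21_hat L T" and ubh: "ub \<in> H21_hat L T"
    and a0: "AE x in lebesgue_on {0<..<L}. ua (x, 0) = w x"
    and b0: "AE x in lebesgue_on {0<..<L}. ub (x, 0) = w x"
    using ua ub by (auto simp: beam_weak_solution_def)
  have \<psi>h: "\<psi> \<in> H21_hat L T" and \<psi>T: "\<And>x. x \<in> {0<..<L} \<Longrightarrow> \<psi> (x, T) = 0"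
    using \<psi> by (auto simp: adjoint_weak_solution_def)
  have hat: "f \<in> H21_hat L T \<Longrightarrow> f \<in> H21 L T" for f by (simp add: H21_hat_def)
  have \<eta>h: "?\<eta> \<in> H21_hat L T" by (rule H21_hat_diff[OF uah ubh])
  have "?\<eta> (x, 0) = 0" if "x \<in> {0<..<L}" for x
  proof (rule continuous_AE_zero[OF open_greaterThanLessThan _ _ that])
    have c: "continuous_on ({0..L} \<times> {0..T}) ?\<eta>" using \<eta>h by (simp add: H21_hat_def)
    have i: "continuous_on {0<..<L} (\<lambda>x::real. (x, 0::real))"
      by (intro continuous_intros)
    have "(\<lambda>x. (x, 0)) ` {0<..<L} \<subseteq> {0..L} \<times> {0..T}" using T by auto
    from continuous_on_compose2[OF c i this]
    show "continuous_on {0<..<L} (\<lambda>x. ?\<eta> (x, 0))" .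
    show "AE x in lebesgue_on {0<..<L}. ?\<eta> (x, 0) = 0"
      using a0 b0 by eventually_elim simp
  qed
  then have adj: "beam_form L T k \<psi> ?\<eta> = - 2 * L2_inner (Omega L T) (\<lambda>z. uc z - y z) ?\<eta>"
    by (rule adjoint_weak_solution_form[OF \<psi> \<eta>h])
  have g: "?g \<in> L2 {0<..<L}" by (rule H21_hat_trace_L2[OF L T \<psi>h])
  have beam_a: "beam_form L T k ua \<psi> = L2_inner (Omega L T) \<psi> F + L2_inner {0<..<L} a ?g"
    by (rule beam_weak_solution_form[OF ua \<psi>h]) (rule \<psi>T)
  have beam_b: "beam_form L T k ub \<psi> = L2_inner (Omega L T) \<psi> F + L2_inner {0<..<L} b ?g"
    by (rule beam_weak_solution_form[OF ub \<psi>h]) (rule \<psi>T)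
  have "beam_form L T k \<psi> ?\<eta> = beam_form L T k ua \<psi> - beam_form L T k ub \<psi>"
    by (subst beam_form_commute) (intro beam_form_diff_left k hat uah ubh \<psi>h)
  also have "\<dots> = L2_inner {0<..<L} ?g (\<lambda>x. a x - b x)"
    using L2_inner_diff_left[OF a b g] L2_inner_commute[of "{0<..<L}" ?g "\<lambda>x. a x - b x"]
    unfolding beam_a beam_b by linarith
  finally show ?thesis using adj by simp
qed

theorem lemma3:
  fixes L T \<alpha> v\<^sub>c :: real
    and k w :: "real \<Rightarrow> real"
    and F y :: "real \<times> real \<Rightarrow> real"
    and u \<psi> :: "(real \<Rightarrow> real) \<Rightarrow> real \<times> real \<Rightarrow> real"
  assumes "L > 0" and "T > 0" and "\<alpha> > 0"
    and "k \<in> Linf {0<..<L}" and "AE x in lebesgue_on {0<..<L}. k x > 0"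
    and "w \<in> H2 {0<..<L}"
    and "F \<in> L2 (Omega L T)" and "y \<in> L2 (Omega L T)"
    and "\<And>v. v \<in> V_ad L v\<^sub>c \<Longrightarrow> beam_weak_solution L T k w v F (u v)"
    and "\<And>v. v \<in> V_ad L v\<^sub>c \<Longrightarrow> adjoint_weak_solution L T k y (u v) (\<psi> v)"
  shows "\<forall>v\<in>V_ad L v\<^sub>c.
    has_frechet_gradient {0<..<L} (V_ad L v\<^sub>c) (cost L T \<alpha> y u) v
      (\<lambda>x. - \<psi> v (x, 0) + 2 * \<alpha> * v x)"
proof
  let ?S = "{0<..<L}" and ?\<Omega> = "Omega L T" and ?V = "V_ad L v\<^sub>c"
  let ?G = "\<lambda>c x. \<psi> c (x, 0)"
  let ?n = "L2_norm ?S"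
  note beam = assms(9) and adj = assms(10) and y = assms(8)
  have VL2: "c \<in> L2 ?S" and Vle: "?n c \<le> v\<^sub>c" if "c \<in> ?V" for c
    using that by (auto simp: V_ad_def)
  have uL2: "u c \<in> L2 ?\<Omega>" if "c \<in> ?V" for c
    using beam[OF that] by (auto simp: beam_weak_solution_def H21_hat_def H21_def)
  have GL2: "?G c \<in> L2 ?S" if "c \<in> ?V" for c
    using adj[OF that] by (intro H21_hat_trace_L2[OF assms(1,2)]) (simp add: adjoint_weak_solution_def)
  have dual: "2 * L2_inner ?\<Omega> (\<lambda>z. u c z - y z) (\<lambda>z. u a z - u b z) = - L2_inner ?S (?G c) (\<lambda>x. a x - b x)"
    if "a \<in> ?V" "b \<in> ?V" "c \<in> ?V" for a b c
    by (rule state_adjoint_duality[OF assms(1,2,4) y VL2 VL2 beam beam adj]) (use that in auto)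
  have dual2: "2 * L2_inner ?\<Omega> (\<lambda>z. u c z - u d z) (\<lambda>z. u a z - u b z)
      = - L2_inner ?S (\<lambda>x. ?G c x - ?G d x) (\<lambda>x. a x - b x)"
    if "a \<in> ?V" "b \<in> ?V" "c \<in> ?V" "d \<in> ?V" for a b c d
  proof -
    have "L2_inner ?\<Omega> (\<lambda>z. (u c z - y z) - (u d z - y z)) (\<lambda>z. u a z - u b z)
        = L2_inner ?\<Omega> (\<lambda>z. u c z - y z) (\<lambda>z. u a z - u b z)
          - L2_inner ?\<Omega> (\<lambda>z. u d z - y z) (\<lambda>z. u a z - u b z)"
      by (intro L2_inner_diff_left L2_diff uL2 y that)
    moreover have "L2_inner ?S (\<lambda>x. ?G c x - ?G d x) (\<lambda>x. a x - b x)
        = L2_inner ?S (?G c) (\<lambda>x. a x - b x) - L2_inner ?S (?G d) (\<lambda>x. a x - b x)"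
      by (intro L2_inner_diff_left L2_diff GL2 VL2 that)
    ultimately show ?thesis
      using dual[OF that(1,2,3)] dual[OF that(1,2,4)] by simp
  qed
  \<comment> \<open>Both sides equal -2 times the inner product of \<open>u c - u d\<close> and
    \<open>u a - u b\<close>, whose arguments may be exchanged.\<close>
  have sym: "L2_inner ?S (\<lambda>x. ?G c x - ?G d x) (\<lambda>x. a x - b x)
      = L2_inner ?S (\<lambda>x. ?G a x - ?G b x) (\<lambda>x. c x - d x)"
    if "a \<in> ?V" "b \<in> ?V" "c \<in> ?V" "d \<in> ?V" for a b c d
    using dual2[OF that] dual2[OF that(3,4,1,2)]
      L2_inner_commute[of ?\<Omega> "\<lambda>z. u c z - u d z" "\<lambda>z. u a z - u b z"] by linarith
  fix v assume v: "v \<in> ?V"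
  define H where "H = {h \<in> L2 ?S. (\<lambda>x. v x + h x) \<in> ?V}"
  let ?D = "\<lambda>h x. ?G (\<lambda>x. v x + h x) x - ?G v x"
  let ?\<delta> = "\<lambda>h z. u (\<lambda>x. v x + h x) z - u v z"
  have HL2: "h \<in> L2 ?S" and HV: "(\<lambda>x. v x + h x) \<in> ?V" if "h \<in> H" for h
    using that by (auto simp: H_def)
  have DL2: "?D h \<in> L2 ?S" if "h \<in> H" for h by (intro L2_diff GL2 HV that v)
  \<comment> \<open>Increments of the adjoint trace at \<open>v\<close>, divided by the norm of the
    control increment; a common bound for them is a Lipschitz estimate at \<open>v\<close>.\<close>
  let ?A = "{\<lambda>x. (1 / ?n h) * ?D h x | h. h \<in> H \<and> ?n h > 0}"
  have "\<exists>C. \<forall>g\<in>?A. ?n g \<le> C"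
  proof (rule L2_uniform_boundedness)
    show "?A \<subseteq> L2 ?S" using DL2 by (auto intro!: L2_scale simp del: times_divide_eq_left)
    fix p assume p: "p \<in> L2 ?S"
    show "\<exists>C. \<forall>g\<in>?A. \<bar>L2_inner ?S g p\<bar> \<le> C"
    proof (cases "v\<^sub>c > 0")
      case True
      \<comment> \<open>Scaling by \<open>s\<close> brings an arbitrary \<open>p\<close> into the
        admissible ball; the summand 1 keeps the denominator positive when \<open>p\<close> has norm
        0. With the zero control, \<open>s * p\<close> becomes a difference of admissible controls,
        to which \<open>sym\<close> applies.\<close>
      define s where "s = v\<^sub>c / (?n p + 1)"
      have n1: "?n p + 1 > 0" using L2_norm_nonneg[of ?S p] by linarith
      then have s: "s > 0" using True by (simp add: s_def)
      have "?n (\<lambda>x. s * p x) = v\<^sub>c * (?n p / (?n p + 1))"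
        using s by (simp add: L2_norm_scale) (simp add: s_def)
      also have "\<dots> \<le> v\<^sub>c * 1" using True n1 by (intro mult_left_mono) auto
      finally have sp: "(\<lambda>x. s * p x) \<in> ?V" using L2_scale[OF p] by (simp add: V_ad_def)
      have zero: "(\<lambda>x. 0) \<in> ?V" using True L2_zero by (simp add: V_ad_def L2_norm_def)
      let ?E = "\<lambda>x. ?G (\<lambda>x. s * p x) x - ?G (\<lambda>x. 0) x"
      have EL2: "?E \<in> L2 ?S" by (intro L2_diff GL2 sp zero)
      have "\<bar>L2_inner ?S (\<lambda>x. (1 / ?n h) * ?D h x) p\<bar> \<le> ?n ?E / s" if h: "h \<in> H" "?n h > 0" for h
      proof -
        \<comment> \<open>Symmetry leaves \<open>h\<close> only in the second argument. As
          \<open>?E\<close> does not depend on \<open>h\<close>, Cauchy-Schwarz and division by the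
          norm of \<open>h\<close> give a uniform bound.\<close>
        have "s * L2_inner ?S (?D h) p = L2_inner ?S ?E h"
          using sym[OF sp zero HV[OF h(1)] v] by (simp add: L2_inner_scale_right)
        then have "\<bar>s * L2_inner ?S (?D h) p\<bar> \<le> ?n ?E * ?n h"
          by (simp only: L2_inner_abs_le[OF EL2 HL2[OF h(1)]])
        then have "s * \<bar>L2_inner ?S (?D h) p\<bar> \<le> ?n ?E * ?n h"
          unfolding abs_mult using s by simp
        then show ?thesis
          unfolding L2_inner_scale_left using s h(2) by (simp add: abs_mult field_simps)
      qed
      then show ?thesis by (intro exI[of _ "?n ?E / s"]) blast
    next
      case False
      \<comment> \<open>Without a positive bound all admissible controls have norm 0, and so have
        their increments, which leaves no quotient to estimate.\<close>
      have "?n h = 0" if h: "h \<in> H" for h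
      proof -
        have "?n (\<lambda>x. (v x + h x) + (- 1) * v x) \<le> ?n (\<lambda>x. v x + h x) + ?n (\<lambda>x. (- 1) * v x)"
          by (intro L2_norm_triangle VL2 HV h L2_scale v)
        also have "\<dots> \<le> 0" unfolding L2_norm_scale using Vle[OF v] Vle[OF HV[OF h]] False by simp
        finally show ?thesis using L2_norm_nonneg[of ?S h] by simp
      qed
      then have "?A = {}" by auto
      then show ?thesis by blast
    qed
  qed
  then obtain C where C: "\<And>g. g \<in> ?A \<Longrightarrow> ?n g \<le> C" by blast
  \<comment> \<open>Duality with both differences equal to \<open>h\<close> expresses the squared
    state increment through \<open>?D h\<close>, whose norm is at most \<open>\<bar>C\<bar>\<close>
    times that of \<open>h\<close> when the latter is positive. The absolute value covers an empty
    \<open>?A\<close>, for which \<open>C\<close> may be negative.\<close>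
  have second: "2 * (L2_norm ?\<Omega> (?\<delta> h))\<^sup>2 \<le> \<bar>C\<bar> * (?n h)\<^sup>2" if h: "h \<in> H" for h
  proof -
    have "2 * (L2_norm ?\<Omega> (?\<delta> h))\<^sup>2 = - L2_inner ?S (?D h) h"
      using dual2[OF HV[OF h] v HV[OF h] v] by (simp add: L2_inner_self)
    also have "\<dots> \<le> ?n (?D h) * ?n h"
      using L2_inner_abs_le[OF DL2[OF h] HL2[OF h]] by linarith
    also have "\<dots> \<le> \<bar>C\<bar> * (?n h)\<^sup>2"
    proof (cases "?n h > 0")
      case True
      have "?n (\<lambda>x. (1 / ?n h) * ?D h x) \<le> \<bar>C\<bar>" using C[of "\<lambda>x. (1 / ?n h) * ?D h x"] h True by force
      then have "?n (?D h) \<le> \<bar>C\<bar> * ?n h"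
        unfolding L2_norm_scale using True by (simp add: field_simps)
      then show ?thesis
        using True mult_right_mono[of "?n (?D h)" "\<bar>C\<bar> * ?n h" "?n h"]
        by (simp add: power2_eq_square mult.assoc)
    next
      case False
      then show ?thesis using L2_norm_nonneg[of ?S h] by simp
    qed
    finally show ?thesis .
  qed
  let ?g = "\<lambda>x. - ?G v x + 2 * \<alpha> * v x"
  have ag: "(\<lambda>x. - 1 * ?G v x) \<in> L2 ?S" "(\<lambda>x. (2 * \<alpha>) * v x) \<in> L2 ?S"
    by (intro L2_scale GL2 VL2 v)+
  \<comment> \<open>The cross term, twice the inner product of \<open>u v - y\<close> with the state
    increment, is by duality minus the pairing of \<open>?G v\<close> with \<open>h\<close>. It
    cancels against the gradient, as does the linear part of the penalty, and the quadratic terms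
    remain.\<close>
  have expand: "cost L T \<alpha> y u (\<lambda>x. v x + h x) - cost L T \<alpha> y u v - L2_inner ?S ?g h
      = (L2_norm ?\<Omega> (?\<delta> h))\<^sup>2 + \<alpha> * (?n h)\<^sup>2" if h: "h \<in> H" for h
  proof -
    have 1: "(L2_norm ?\<Omega> (\<lambda>z. (u v z - y z) + ?\<delta> h z))\<^sup>2
        = (L2_norm ?\<Omega> (\<lambda>z. u v z - y z))\<^sup>2 - L2_inner ?S (?G v) h + (L2_norm ?\<Omega> (?\<delta> h))\<^sup>2"
      using L2_norm_square_add[of "\<lambda>z. u v z - y z" ?\<Omega> "?\<delta> h"] dual[OF HV[OF h] v v]
      by (simp add: L2_diff uL2 y v HV[OF h])
    have 2: "(?n (\<lambda>x. v x + h x))\<^sup>2 = (?n v)\<^sup>2 + 2 * L2_inner ?S v h + (?n h)\<^sup>2"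
      by (rule L2_norm_square_add[OF VL2[OF v] HL2[OF h]])
    have 3: "L2_inner ?S ?g h = - L2_inner ?S (?G v) h + 2 * \<alpha> * L2_inner ?S v h"
      using L2_inner_add_left[OF ag HL2[OF h]]
        L2_inner_scale_left[of ?S "- 1" "?G v" h] L2_inner_scale_left[of ?S "2 * \<alpha>" v h] by simp
    show ?thesis
      using 1 2 3 unfolding cost_def L2_norm_square[symmetric] by (simp add: algebra_simps)
  qed
  show "has_frechet_gradient ?S ?V (cost L T \<alpha> y u) v ?g"
    unfolding has_frechet_gradient_def
  proof (intro conjI allI impI)
    show "?g \<in> L2 ?S" using L2_add[OF ag] by simp
    fix \<epsilon> :: real assume \<epsilon>: "\<epsilon> > 0"
    \<comment> \<open>The state increment contributes at most \<open>\<bar>C\<bar> / 2\<close> and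
      the penalty \<open>\<alpha>\<close>, so the remainder is at most \<open>K\<close> times the
      squared norm of \<open>h\<close>, and \<open>\<epsilon> / K\<close> serves as the
      radius.\<close>
    define K where "K = \<bar>C\<bar> / 2 + \<alpha>"
    have K: "K > 0" using assms(3) by (simp add: K_def add_nonneg_pos)
    show "\<exists>\<delta>>0. \<forall>h\<in>L2 ?S. (\<lambda>x. v x + h x) \<in> ?V \<longrightarrow> ?n h < \<delta> \<longrightarrow>
        \<bar>cost L T \<alpha> y u (\<lambda>x. v x + h x) - cost L T \<alpha> y u v - L2_inner ?S ?g h\<bar> \<le> \<epsilon> * ?n h"
    proof (intro exI[of _ "\<epsilon> / K"] conjI ballI impI)
      show "\<epsilon> / K > 0" using \<epsilon> K by simp
      fix h assume "h \<in> L2 ?S" "(\<lambda>x. v x + h x) \<in> ?V" and small: "?n h < \<epsilon> / K"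
      then have h: "h \<in> H" by (simp add: H_def)
      have "0 \<le> (L2_norm ?\<Omega> (?\<delta> h))\<^sup>2 + \<alpha> * (?n h)\<^sup>2" using assms(3) by simp
      moreover have "(L2_norm ?\<Omega> (?\<delta> h))\<^sup>2 + \<alpha> * (?n h)\<^sup>2 \<le> (K * ?n h) * ?n h"
        using second[OF h] by (simp add: K_def power2_eq_square algebra_simps)
      moreover have "(K * ?n h) * ?n h \<le> \<epsilon> * ?n h"
        using small K by (intro mult_right_mono L2_norm_nonneg) (simp add: field_simps)
      ultimately show "\<bar>cost L T \<alpha> y u (\<lambda>x. v x + h x) - cost L T \<alpha> y u v - L2_inner ?S ?g h\<bar> \<le> \<epsilon> * ?n h"
        unfolding expand[OF h] by linarith
    qed
  qed
qed

end
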